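(* Let $E$ be a sequentially complete Hausdorff locally convex space, $1\leq p<\infty$ and $\gamma\in L^p([0,1],E)$. For $n\in\mathbb{N}$ and $j\in\{1,\dots,2^n\}$ let $I_j=I_j^{(n)}=\left[\frac{j-1}{2^n},\frac{j}{2^n}\right]$ be the intervals of the dyadic partition $\pi_n$ of $[0,1]$, and define the simple function \[ \gamma_n:[0,1]\to E,\quad \gamma_n(t)=\sum_{j=1}^{2^n}\left(2^n\int_{I_j}\gamma(s)\,ds\right)\chi_{I_j}(t). \] Then the sequence $(\gamma_n)_n$ converges to $\gamma$ in $L^p([0,1],E)$.
   Context: All locally convex spaces are real. $\lambda$ is Lebesgue measure on $[0,1]$, and $\chi_A$ is the characteristic function of $A$. A function $\gamma:[0,1]\to E$ is Lusin-measurable if for each $\varepsilon>0$ there is a compact $K_\varepsilon\subseteq[0,1]$ with $\lambda([0,1]\setminus K_\varepsilon)\leq\varepsilon$ and $\gamma|_{K_\varepsilon}$ continuous. $\mathcal{L}^p([0,1],E)$ is the set of Lusin-measurable $\gamma:[0,1]\to E$ such that $q\circ\gamma\in\mathcal{L}^p([0,1],\mathbb{R})$ for each continuous seminorm $q$ on $E$. $L^p([0,1],E)$ is its quotient by almost everywhere equality (a function is identified with its class), with the locally convex topology defined by the seminorms $\lVert\gamma\rVert_{\mathcal{L}^p,q}=\left(\int_0^1 q(\gamma(t))^p\,dt\right)^{1/p}$, where $q$ ranges over the continuous seminorms on $E$. One has $L^p([0,1],E)\subseteq L^1([0,1],E)$. The integrals $\int_{I_j}\gamma(s)\,ds\in E$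 are Pettis (weak) integrals: $\int_{I_j}\gamma(s)\,ds$ is the unique $z\in E$ with $f(z)=\int_{I_j}f(\gamma(s))\,ds$ for all $f$ in the topological dual $E'$. It is a known result that, when $E$ is a sequentially complete Hausdorff locally convex space, every $\gamma\in\mathcal{L}^1([0,1],E)$ is Pettis integrable over $[0,1]$ and over its subintervals, so these elements exist. *)

theory Defs
  imports "HOL-Analysis.Analysis"
begin

text \<open>
  Real locally convex spaces, not necessarily Hausdorff. The parent class
  \<^class>\<open>uniform_topological_group_add\<close> requires addition and negation to be uniformly
  continuous, which forces the uniformity to be the canonical one of a topological vector space,
  generated by the sets of all \<open>(x, y)\<close> with \<open>x - y\<close> in a given neighbourhood of \<open>0\<close>. Hence
  \<^const>\<open>Cauchy\<close> has its usual meaning for topological vector spaces. The second axiom states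
  that \<open>0\<close> has a base of convex neighbourhoods; it spells out \<^const>\<open>convex\<close>, which cannot be
  used inside the class declaration.
\<close>
class locally_convex_space = real_vector + uniform_topological_group_add +
  assumes tendsto_scaleR_Pair: "LIM x (nhds a \<times>\<^sub>F nhds b). fst x *\<^sub>R snd x :> nhds (a *\<^sub>R b)"
    and locally_convex: "open U \<Longrightarrow> 0 \<in> U \<Longrightarrow> \<exists>V. open V \<and> 0 \<in> V \<and> V \<subseteq> U \<and>
      (\<forall>x\<in>V. \<forall>y\<in>V. \<forall>u\<ge>0. \<forall>v\<ge>0. u + v = 1 \<longrightarrow> u *\<^sub>R x + v *\<^sub>R y \<in> V)"

instance real :: locally_convex_space
proof
  fix a b :: real
  show "LIM x (nhds a \<times>\<^sub>F nhds b). fst x *\<^sub>R snd x :> nhds (a *\<^sub>R b)"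
    by (intro tendsto_scaleR filterlim_fst filterlim_snd)
next
  fix U :: "real set"
  assume "open U" "0 \<in> U"
  then obtain e where "e > 0" "ball 0 e \<subseteq> U"
    by (meson open_contains_ball)
  moreover have "convex (ball (0::real) e)"
    by (rule convex_ball)
  ultimately show "\<exists>V. open V \<and> 0 \<in> V \<and> V \<subseteq> U \<and>
      (\<forall>x\<in>V. \<forall>y\<in>V. \<forall>u\<ge>0. \<forall>v\<ge>0. u + v = 1 \<longrightarrow> u *\<^sub>R x + v *\<^sub>R y \<in> V)"
    unfolding convex_def by (intro exI[of _ "ball 0 e"]) auto
qed

definition sequentially_complete :: "'a::uniform_space itself \<Rightarrow> bool"
  where "sequentially_complete TYPE('a) \<longleftrightarrow> (\<forall>X :: nat \<Rightarrow> 'a. Cauchy X \<longrightarrow> convergent X)"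

definition continuous_seminorm :: "('a::{real_vector,topological_space} \<Rightarrow> real) \<Rightarrow> bool"
  where "continuous_seminorm q \<longleftrightarrow>
    (\<forall>x. 0 \<le> q x) \<and> (\<forall>x y. q (x + y) \<le> q x + q y) \<and> (\<forall>c x. q (c *\<^sub>R x) = \<bar>c\<bar> * q x) \<and>
    continuous_on UNIV q"

text \<open>
  A function on the unit interval is represented by a total function on the reals;
  all notions below depend only on its values on \<open>{0..1}\<close>.
\<close>
definition lusin_measurable :: "(real \<Rightarrow> 'a::topological_space) \<Rightarrow> bool"
  where "lusin_measurable \<gamma> \<longleftrightarrow>
    (\<forall>\<epsilon>>0. \<exists>K. compact K \<and> K \<subseteq> {0..1} \<and> measure lebesgue ({0..1} - K) \<le> \<epsilon> \<and> continuous_on K \<gamma>)"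

definition Lp_fun_real :: "real \<Rightarrow> (real \<Rightarrow> real) set"
  where "Lp_fun_real p =
    {f \<in> borel_measurable (lebesgue_on {0..1}). integrable (lebesgue_on {0..1}) (\<lambda>t. \<bar>f t\<bar> powr p)}"

definition Lp_fun :: "real \<Rightarrow> (real \<Rightarrow> 'a::locally_convex_space) set"
  where "Lp_fun p = {\<gamma>. lusin_measurable \<gamma> \<and> (\<forall>q. continuous_seminorm q \<longrightarrow> q \<circ> \<gamma> \<in> Lp_fun_real p)}"

definition Lp_seminorm :: "real \<Rightarrow> ('a \<Rightarrow> real) \<Rightarrow> (real \<Rightarrow> 'a) \<Rightarrow> real"
  where "Lp_seminorm p q \<gamma> = (LINT t|lebesgue_on {0..1}. q (\<gamma> t) powr p) powr (1 / p)"

definition Lp_rel :: "real \<Rightarrow> ((real \<Rightarrow> 'a::locally_convex_space) \<times> (real \<Rightarrow> 'a)) set"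
  where "Lp_rel p =
    {(\<gamma>, \<eta>). \<gamma> \<in> Lp_fun p \<and> \<eta> \<in> Lp_fun p \<and> (AE t in lebesgue_on {0..1}. \<gamma> t = \<eta> t)}"

definition Lp_class :: "real \<Rightarrow> (real \<Rightarrow> 'a::locally_convex_space) \<Rightarrow> (real \<Rightarrow> 'a) set"
  where "Lp_class p \<gamma> = Lp_rel p `` {\<gamma>}"

text \<open>
  The locally convex topology on the quotient \<open>Lp_fun p // Lp_rel p\<close>, generated by the open
  balls of the seminorms. The value of \<open>Lp_seminorm p q\<close> depends only on the class of its
  argument, so each generating set is the ball of classes around the class of \<open>\<gamma>\<close>.
\<close>
definition Lp_topology :: "real \<Rightarrow> (real \<Rightarrow> 'a::locally_convex_space) set topology"
  where "Lp_topology p = topology_generated_by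
    {Lp_class p ` {\<eta> \<in> Lp_fun p. Lp_seminorm p q (\<lambda>t. \<eta> t - \<gamma> t) < \<epsilon>} | q \<gamma> \<epsilon>.
      continuous_seminorm q \<and> \<gamma> \<in> Lp_fun p \<and> \<epsilon> > 0}"

lemma topspace_Lp_topology:
  "topspace (Lp_topology p) = (Lp_fun p // Lp_rel p :: (real \<Rightarrow> 'a::locally_convex_space) set set)"
proof -
  have seminorm_0: "continuous_seminorm (\<lambda>x::'a. 0)"
    by (simp add: continuous_seminorm_def)
  have "Lp_class p \<gamma> \<in> topspace (Lp_topology p)" if \<gamma>: "\<gamma> \<in> Lp_fun p" for \<gamma> :: "real \<Rightarrow> 'a"
  proof -
    have "Lp_class p \<gamma> \<in> Lp_class p ` {\<eta> \<in> Lp_fun p. Lp_seminorm p (\<lambda>x. 0) (\<lambda>t. \<eta> t - \<gamma> t) < 1}"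
      using \<gamma> by (auto simp: Lp_seminorm_def)
    then show ?thesis
      using \<gamma> seminorm_0 unfolding Lp_topology_def topology_generated_by_topspace
      by (intro UnionI[of "Lp_class p ` {\<eta> \<in> Lp_fun p. Lp_seminorm p (\<lambda>x. 0) (\<lambda>t. \<eta> t - \<gamma> t) < 1}"])
         (auto intro!: exI[of _ "\<lambda>x::'a. 0"] exI[of _ \<gamma>] exI[of _ "1::real"])
  qed
  moreover have "topspace (Lp_topology p) \<subseteq> Lp_class p ` (Lp_fun p :: (real \<Rightarrow> 'a) set)"
    unfolding Lp_topology_def topology_generated_by_topspace by blast
  ultimately have "topspace (Lp_topology p) = Lp_class p ` (Lp_fun p :: (real \<Rightarrow> 'a) set)"
    by blast
  then show ?thesis
    by (auto simp: quotient_def Lp_class_def)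
qed

definition has_pettis_integral ::
    "(real \<Rightarrow> 'a::{real_vector,topological_space}) \<Rightarrow> 'a \<Rightarrow> real set \<Rightarrow> bool"
  where "has_pettis_integral \<gamma> z S \<longleftrightarrow>
    (\<forall>f :: 'a \<Rightarrow> real. linear f \<and> continuous_on UNIV f \<longrightarrow>
      integrable (lebesgue_on S) (\<lambda>s. f (\<gamma> s)) \<and> f z = (LINT s|lebesgue_on S. f (\<gamma> s)))"

definition pettis_integral :: "real set \<Rightarrow> (real \<Rightarrow> 'a::{real_vector,topological_space}) \<Rightarrow> 'a"
  where "pettis_integral S \<gamma> = (THE z. has_pettis_integral \<gamma> z S)"

definition dyadic_interval :: "nat \<Rightarrow> nat \<Rightarrow> real set"
  where "dyadic_interval n j = {(real j - 1) / 2 ^ n .. real j / 2 ^ n}"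

definition dyadic_average ::
    "(real \<Rightarrow> 'a::{real_vector,topological_space}) \<Rightarrow> nat \<Rightarrow> real \<Rightarrow> 'a"
  where "dyadic_average \<gamma> n t =
    (\<Sum>j = 1..2 ^ n. indicat_real (dyadic_interval n j) t *\<^sub>R
      (2 ^ n *\<^sub>R pettis_integral (dyadic_interval n j) \<gamma>))"

end

theory Submission
  imports Defs
begin

text \<open>
  Pettis integrals exist because a functional on the dual that is approximated by points of \<open>E\<close>,
  uniformly on the polar of every seminorm, is represented by a point. On a compact set where
  \<open>\<gamma>\<close> is continuous the approximating points are Riemann sums; in general they are the integrals
  over an increasing exhausting sequence of such compact sets.

  For the convergence, fix a seminorm \<open>q\<close>. Truncation of \<open>q \<circ> \<gamma>\<close> and uniform continuity of
  \<open>\<gamma>\<close> on a large compact set show that for large \<open>n\<close> some function that is constant on the dyadic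
  intervals of level \<open>n\<close> is close to \<open>\<gamma>\<close>. By Hahn--Banach and Jensen's inequality, averaging over
  these intervals is a contraction in \<open>L\<^sup>p\<close> and fixes such step functions, so the averages of
  \<open>\<gamma>\<close> are close to \<open>\<gamma>\<close>, too.
\<close>

subsection \<open>Minimal sublinear functionals and the Hahn--Banach theorem\<close>

text \<open>\<open>E\<close> need not be metrizable and is only sequentially complete. The points
  that approximate an integral must therefore form a single sequence, fixed before any seminorm is
  named; only the index from which it is good may depend on the seminorm. Riemann sums along the
  dyadic partitions have this form, and so do integrals over an exhaustion by compact sets, because
  the compact sets in Lusin measurability do not depend on a seminorm either. Polars enter because,
  by Hahn--Banach, \<open>q x\<close> is the maximum of \<open>\<bar>f x\<bar>\<close> over all
  linear \<open>f\<close> with \<open>\<bar>f\<bar> \<le> q\<close>. A scalar estimate that is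
  uniform over these \<open>f\<close> is thus an estimate for \<open>q\<close>, and every continuous
  linear \<open>f\<close> belongs to the polar of its own seminorm \<open>\<bar>f\<bar>\<close>.
  Accordingly no vector integral is ever estimated directly: a norming functional replaces it by a
  real integral, to which dominated convergence or Jensen's inequality applies.\<close>

definition sublinear :: "('a::real_vector \<Rightarrow> real) \<Rightarrow> bool"
  where "sublinear q \<longleftrightarrow> (\<forall>x y. q (x + y) \<le> q x + q y) \<and> (\<forall>c\<ge>0. \<forall>x. q (c *\<^sub>R x) = c * q x)"

lemma sublinear_add: "sublinear q \<Longrightarrow> q (x + y) \<le> q x + q y"
  and sublinear_scaleR: "sublinear q \<Longrightarrow> 0 \<le> c \<Longrightarrow> q (c *\<^sub>R x) = c * q x"
  by (auto simp: sublinear_def)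

lemma sublinear_zero: "sublinear q \<Longrightarrow> q 0 = 0"
  using sublinear_scaleR[of q 0 0] by simp

lemma sublinear_minus: "sublinear q \<Longrightarrow> - q (- x) \<le> q x"
  using sublinear_add[of q x "- x"] sublinear_zero[of q] by simp

text \<open>The bound at \<open>x + y\<close> may come from a third index \<open>k\<close>, which
  covers both uses: the half-line of parameters \<open>t\<close>, where \<open>k\<close> is a sum,
  and a chain of functionals, where \<open>k\<close> is the smaller one. The lower bound
  \<open>b\<close> keeps the real infimum meaningful. Homogeneity follows from the one-sided
  estimate for \<open>c\<close> and for \<open>inverse c\<close>.\<close>

lemma sublinear_INF:
  fixes P :: "'i \<Rightarrow> 'a::real_vector \<Rightarrow> real"
  assumes "I \<noteq> {}" and bdd: "\<And>i x. i \<in> I \<Longrightarrow> b x \<le> P i x"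
    and add: "\<And>i j x y. i \<in> I \<Longrightarrow> j \<in> I \<Longrightarrow> \<exists>k\<in>I. P k (x + y) \<le> P i x + P j y"
    and scale: "\<And>i c x. i \<in> I \<Longrightarrow> 0 < c \<Longrightarrow> \<exists>k\<in>I. P k (c *\<^sub>R x) \<le> c * P i x"
  shows "sublinear (\<lambda>x. INF i\<in>I. P i x)"
proof -
  define r where "r x = (INF i\<in>I. P i x)" for x
  have r_le: "r x \<le> P i x" if "i \<in> I" for i x
    unfolding r_def using that bdd by (intro cINF_lower) (auto simp: bdd_below_def)
  have r_ge: "c \<le> r x" if "\<And>i. i \<in> I \<Longrightarrow> c \<le> P i x" for c x
    unfolding r_def using that \<open>I \<noteq> {}\<close> by (intro cINF_greatest) auto
  have subadd: "r (x + y) \<le> r x + r y" for x y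
  proof -
    have *: "r (x + y) \<le> P i x + P j y" if "i \<in> I" "j \<in> I" for i j
      using add[OF that] r_le order_trans by blast
    have "r (x + y) - P j y \<le> r x" if "j \<in> I" for j
      using *[OF _ that] by (intro r_ge) (simp add: algebra_simps)
    then have "r (x + y) - r x \<le> r y"
      by (intro r_ge) (simp add: algebra_simps)
    then show ?thesis
      by simp
  qed
  have scale_le: "r (c *\<^sub>R x) \<le> c * r x" if "0 < c" for c x
  proof -
    have "r (c *\<^sub>R x) / c \<le> r x"
    proof (rule r_ge)
      fix i assume "i \<in> I"
      then obtain k where "k \<in> I" "P k (c *\<^sub>R x) \<le> c * P i x"
        using scale \<open>0 < c\<close> by blast
      then have "r (c *\<^sub>R x) \<le> c * P i x"
        using r_le order_trans by blast
      then show "r (c *\<^sub>R x) / c \<le> P i x"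
        using \<open>0 < c\<close> by (simp add: divide_le_eq mult.commute)
    qed
    then show ?thesis
      using \<open>0 < c\<close> by (simp add: divide_le_eq mult.commute)
  qed
  have "r (c *\<^sub>R x) = c * r x" if c: "0 \<le> c" for c x
  proof (cases "c = 0")
    \<comment> \<open>The factors 2 and 1/2 give \<open>r 0 \<le> 2 * r 0\<close> and
      \<open>r 0 \<le> r 0 / 2\<close>, hence \<open>r 0 = 0\<close>.\<close>
    case True
    then show ?thesis
      using scale_le[of 2 0] scale_le[of "1/2" 0] by simp
  next
    case False
    with c have "0 < c"
      by simp
    have "r x \<le> inverse c * r (c *\<^sub>R x)"
      using scale_le[of "inverse c" "c *\<^sub>R x"] \<open>0 < c\<close> by simp
    then have "c * r x \<le> r (c *\<^sub>R x)"
      using \<open>0 < c\<close> by (simp add: field_simps)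
    with scale_le[OF \<open>0 < c\<close>] show ?thesis
      by (rule antisym)
  qed
  with subadd show ?thesis
    by (simp add: sublinear_def r_def)
qed

text \<open>The witness \<open>r\<close> is the directional infimum of \<open>q (x + t *\<^sub>R z) - t * q z\<close> over \<open>t \<ge> 0\<close>.
  Applied to a minimal sublinear functional, it shows that the functional is odd, hence linear.\<close>
lemma sublinear_directional:
  assumes q: "sublinear q"
  obtains r where "sublinear r" "\<And>x. r x \<le> q x" "r (- z) \<le> - q z"
proof -
  define P where "P t x = q (x + t *\<^sub>R z) - t * q z" for t x
  define r where "r x = (INF t\<in>{0..}. P t x)" for x
  have lower: "- q (- x) \<le> P t x" if "t \<ge> 0" for t x
  proof -
    have "t * q z = q ((x + t *\<^sub>R z) + - x)"
      using that by (simp add: sublinear_scaleR[OF q])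
    also have "\<dots> \<le> q (x + t *\<^sub>R z) + q (- x)"
      by (rule sublinear_add[OF q])
    finally show ?thesis
      by (simp add: P_def)
  qed
  have r_le: "r x \<le> P t x" if "t \<ge> 0" for t x
    unfolding r_def using that lower by (intro cINF_lower) (auto simp: bdd_below_def)
  have "sublinear r"
    unfolding r_def
  proof (rule sublinear_INF)
    show "\<exists>k\<in>{0..}. P k (x + y) \<le> P s x + P t y" if "s \<in> {0..}" "t \<in> {0..}" for s t x y
      using that sublinear_add[OF q, of "x + s *\<^sub>R z" "y + t *\<^sub>R z"]
      by (intro bexI[of _ "s + t"]) (simp_all add: P_def algebra_simps)
    show "\<exists>k\<in>{0..}. P k (c *\<^sub>R x) \<le> c * P t x" if "t \<in> {0..}" "0 < c" for t c x
      using that sublinear_scaleR[OF q, of c "x + t *\<^sub>R z"]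
      by (intro bexI[of _ "c * t"]) (simp_all add: P_def algebra_simps)
  qed (use lower in auto)
  moreover have "r x \<le> q x" for x
    using r_le[of 0 x] by (simp add: P_def)
  moreover have "r (- z) \<le> - q z"
    using r_le[of 1 "- z"] by (simp add: P_def sublinear_zero[OF q])
  ultimately show thesis
    by (rule that)
qed

text \<open>Zorn's lemma applies because the pointwise infimum of a chain is again sublinear. It is
  finite: each \<open>r\<close> below \<open>q\<close> satisfies
  \<open>r x \<ge> - r (- x) \<ge> - q (- x)\<close>, a bound common to the whole chain.\<close>

lemma sublinear_minimal:
  assumes q: "sublinear q"
  obtains r where "sublinear r" "\<And>x. r x \<le> q x"
    "\<And>s. sublinear s \<Longrightarrow> (\<And>x. s x \<le> r x) \<Longrightarrow> s = r"
proof -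
  define A where "A = {r. sublinear r \<and> (\<forall>x. r x \<le> q x)}"
  \<comment> \<open>The order is reversed, so that the maximal element supplied by Zorn's lemma is a
    minimal functional.\<close>
  define R :: "('a \<Rightarrow> real) \<Rightarrow> ('a \<Rightarrow> real) \<Rightarrow> bool" where "R r s \<longleftrightarrow> s \<le> r" for r s
  have "\<exists>m\<in>A. \<forall>s\<in>A. R m s \<longrightarrow> s = m"
  proof (rule predicate_Zorn)
    show "partial_order_on A (relation_of R A)"
      by (auto simp: partial_order_on_def preorder_on_def refl_on_def trans_def antisym_def
          relation_of_def R_def)
    fix C assume C: "C \<in> Chains (relation_of R A)"
    then have chain: "r \<le> s \<or> s \<le> r" if "r \<in> C" "s \<in> C" for r s
      using that by (auto simp: Chains_def relation_of_def R_def)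
    show "\<exists>u\<in>A. \<forall>r\<in>C. R r u"
    proof (cases "C = {}")
      case True
      then show ?thesis
        using q by (auto simp: A_def)
    next
      case False
      have C_A: "r \<in> A" if "r \<in> C" for r
        using C that by (auto simp: Chains_def relation_of_def)
      define u where "u x = (INF r\<in>C. r x)" for x
      have lower: "- q (- x) \<le> r x" if "r \<in> C" for r x
      proof -
        have "sublinear r" "r (- x) \<le> q (- x)"
          using C_A[OF that] by (auto simp: A_def)
        then show ?thesis
          using sublinear_minus[of r x] by linarith
      qed
      have u_le: "u x \<le> r x" if "r \<in> C" for r x
        unfolding u_def using that lower by (intro cINF_lower) (auto simp: bdd_below_def)
      have "sublinear u"
        unfolding u_def
      proof (rule sublinear_INF)
        show "\<exists>k\<in>C. k (x + y) \<le> r x + s y" if "r \<in> C" "s \<in> C" for r s x y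
        proof (cases "r \<le> s")
          case True
          then have "r (x + y) \<le> r x + s y"
            using sublinear_add[of r x y] C_A[OF \<open>r \<in> C\<close>]
            by (auto simp: A_def le_fun_def intro: order_trans add_mono)
          then show ?thesis
            using that by blast
        next
          case False
          then have "s \<le> r"
            using chain[OF that] by blast
          then have "s (x + y) \<le> r x + s y"
            using sublinear_add[of s x y] C_A[OF \<open>s \<in> C\<close>]
            by (auto simp: A_def le_fun_def intro: order_trans add_mono)
          then show ?thesis
            using that by blast
        qed
        show "\<exists>k\<in>C. k (c *\<^sub>R x) \<le> c * r x" if "r \<in> C" "0 < c" for r c x
          using that C_A[OF \<open>r \<in> C\<close>]
          by (intro bexI[of _ r]) (simp_all add: A_def sublinear_scaleR)
      qed (use lower False in auto)
      moreover have "u x \<le> q x" for x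
      proof -
        obtain r where "r \<in> C"
          using False by blast
        then show ?thesis
          using C_A[OF \<open>r \<in> C\<close>] u_le[OF \<open>r \<in> C\<close>, of x] by (auto simp: A_def intro: order_trans)
      qed
      ultimately show ?thesis
        using u_le by (auto simp: A_def R_def le_fun_def intro!: bexI[of _ u])
    qed
  qed
  then obtain m where m: "m \<in> A" "\<And>s. s \<in> A \<Longrightarrow> s \<le> m \<Longrightarrow> s = m"
    by (auto simp: R_def)
  show thesis
  proof (rule that[of m])
    show "sublinear m" "m x \<le> q x" for x
      using m(1) by (auto simp: A_def)
    show "s = m" if "sublinear s" "\<And>x. s x \<le> m x" for s
      using m(1) that by (intro m(2)) (auto simp: A_def le_fun_def intro: order_trans)
  qed
qed

text \<open>No extension from a subspace takes place. A minimal sublinear functional admits nothing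
  strictly below it, so its directional infimum in the direction \<open>x\<close> equals it; this
  makes it odd, and an odd sublinear functional is linear.\<close>

theorem Hahn_Banach_sublinear:
  fixes q :: "'a::real_vector \<Rightarrow> real"
  assumes q: "sublinear q"
  obtains f where "linear f" "\<And>x. f x \<le> q x" "f z = q z"
proof -
  \<comment> \<open>Minimality alone gives some linear \<open>f\<close> below \<open>q\<close>.
    Starting from \<open>q'\<close> also forces \<open>f (- z) \<le> - q z\<close>, hence contact
    with \<open>q\<close> at \<open>z\<close>.\<close>
  obtain q' where q': "sublinear q'" "\<And>x. q' x \<le> q x" "q' (- z) \<le> - q z"
    using sublinear_directional[OF q] by blast
  obtain f where f: "sublinear f" "\<And>x. f x \<le> q' x"
    and min: "\<And>s. sublinear s \<Longrightarrow> (\<And>x. s x \<le> f x) \<Longrightarrow> s = f"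
    using sublinear_minimal[OF q'(1)] by blast
  have f_minus: "f (- x) = - f x" for x
  proof (rule antisym)
    obtain r where r: "sublinear r" "\<And>x. r x \<le> f x" "r (- x) \<le> - f x"
      using sublinear_directional[OF f(1)] by blast
    then have "r = f"
      by (intro min)
    with r(3) show "f (- x) \<le> - f x"
      by simp
    show "- f x \<le> f (- x)"
      using sublinear_minus[OF f(1), of "- x"] by simp
  qed
  have "linear f"
  proof (rule linearI)
    show "f (x + y) = f x + f y" for x y
      using sublinear_add[OF f(1), of x y] sublinear_add[OF f(1), of "x + y" "- y"]
      by (simp add: f_minus)
    show "f (c *\<^sub>R x) = c *\<^sub>R f x" for c x
      using sublinear_scaleR[OF f(1), of "\<bar>c\<bar>" x] f_minus[of "\<bar>c\<bar> *\<^sub>R x"]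
      by (cases "c \<ge> 0") auto
  qed
  moreover have "f x \<le> q x" for x
    using f(2) q'(2) order_trans by blast
  moreover have "f z = q z"
    using f(2)[of "- z"] q'(3) \<open>f z \<le> q z\<close> by (simp add: f_minus)
  ultimately show thesis
    by (rule that)
qed

subsection \<open>Continuous seminorms\<close>

lemma tendsto_scaleR_lcs:
  fixes g :: "'b \<Rightarrow> 'a::locally_convex_space"
  assumes "(f \<longlongrightarrow> a) F" "(g \<longlongrightarrow> b) F"
  shows "((\<lambda>x. f x *\<^sub>R g x) \<longlongrightarrow> a *\<^sub>R b) F"
  using filterlim_compose[OF tendsto_scaleR_Pair filterlim_Pair[OF assms]] by simp

lemma continuous_on_scaleR_lcs:
  fixes g :: "'b::topological_space \<Rightarrow> 'a::locally_convex_space"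
  assumes "continuous_on S f" "continuous_on S g"
  shows "continuous_on S (\<lambda>x. f x *\<^sub>R g x)"
  using assms unfolding continuous_on_def by (auto intro: tendsto_scaleR_lcs)

lemma continuous_seminormD:
  assumes "continuous_seminorm q"
  shows "0 \<le> q x" "q (x + y) \<le> q x + q y" "q (c *\<^sub>R x) = \<bar>c\<bar> * q x" "continuous_on UNIV q"
    "q 0 = 0" "q (- x) = q x" "q (x - y) = q (y - x)"
proof -
  show scale: "q (c *\<^sub>R x) = \<bar>c\<bar> * q x" for c x
    using assms by (simp add: continuous_seminorm_def)
  show "0 \<le> q x" "q (x + y) \<le> q x + q y" "continuous_on UNIV q"
    using assms by (simp_all add: continuous_seminorm_def)
  show "q 0 = 0" "q (- x) = q x"
    using scale[of 0 0] scale[of "- 1" x] by simp_all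
  show "q (x - y) = q (y - x)"
    using scale[of "- 1" "x - y"] by simp
qed

lemma continuous_seminorm_diff_le:
  fixes q :: "'a::{real_vector,topological_space} \<Rightarrow> real"
  assumes "continuous_seminorm q"
  shows "q (x - y) \<le> q x + q y"
  using continuous_seminormD(2)[OF assms, of x "- y"] continuous_seminormD(6)[OF assms, of y] by simp

lemma continuous_on_seminorm_diff:
  fixes q :: "'a::locally_convex_space \<Rightarrow> real"
  assumes q: "continuous_seminorm q" and "continuous_on S f" "continuous_on S g"
  shows "continuous_on S (\<lambda>x. q (f x - g x))"
  using continuous_on_compose2[OF continuous_seminormD(4)[OF q], of S "\<lambda>x. f x - g x"] assms(2,3)
  by (auto intro: continuous_on_diff)

lemma seminorm_sublinear: "continuous_seminorm q \<Longrightarrow> sublinear q"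
  by (auto simp: continuous_seminorm_def sublinear_def)

lemma continuous_seminorm_abs_linear:
  assumes "linear f" "continuous_on UNIV f"
  shows "continuous_seminorm (\<lambda>x. \<bar>f x\<bar>)"
  unfolding continuous_seminorm_def
  using assms by (auto simp: linear_add linear_scale abs_mult intro: continuous_intros)

text \<open>Homogeneity turns the bound 1 on \<open>V\<close> into arbitrarily small bounds near 0,
  and the reverse triangle inequality carries continuity from 0 to every point.\<close>

lemma seminorm_continuous_at_zero:
  fixes q :: "'a::locally_convex_space \<Rightarrow> real"
  assumes nonneg: "\<And>x. 0 \<le> q x" and add: "\<And>x y. q (x + y) \<le> q x + q y"
    and scale: "\<And>c x. q (c *\<^sub>R x) = \<bar>c\<bar> * q x"
    and nbhd: "open V" "0 \<in> V" "\<And>x. x \<in> V \<Longrightarrow> q x \<le> 1"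
  shows "continuous_seminorm q"
proof -
  have small: "\<forall>\<^sub>F x in nhds 0. q x < e" if "e > 0" for e
  proof -
    \<comment> \<open>The factor \<open>2 / e\<close> yields \<open>q x \<le> e / 2\<close>, which
      makes the required inequality strict.\<close>
    have "((\<lambda>x. (2 / e) *\<^sub>R x) \<longlongrightarrow> (2 / e) *\<^sub>R 0) (nhds (0::'a))"
      by (intro tendsto_scaleR_lcs tendsto_const filterlim_ident)
    then have "\<forall>\<^sub>F x in nhds 0. (2 / e) *\<^sub>R x \<in> V"
      using nbhd(1,2) by (auto dest: topological_tendstoD)
    then show ?thesis
    proof eventually_elim
      case (elim x)
      then have "2 / e * q x \<le> 1"
        using nbhd(3)[OF elim] that by (simp add: scale)
      then show ?case
        using that by (simp add: field_simps)
    qed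
  qed
  have "(q \<longlongrightarrow> q y) (at y)" for y
  proof (rule tendstoI)
    fix e :: real assume "e > 0"
    have "((\<lambda>x. x - y) \<longlongrightarrow> y - y) (at y)"
      by (intro tendsto_diff tendsto_const) (simp add: filterlim_at)
    then have "filterlim (\<lambda>x. x - y) (nhds 0) (at y)"
      by simp
    then have "\<forall>\<^sub>F x in at y. q (x - y) < e"
      using small[OF \<open>e > 0\<close>] unfolding filterlim_iff by blast
    then show "\<forall>\<^sub>F x in at y. dist (q x) (q y) < e"
    proof eventually_elim
      case (elim x)
      have "q x \<le> q (x - y) + q y" "q y \<le> q (y - x) + q x"
        using add[of "x - y" y] add[of "y - x" x] by simp_all
      moreover have "q (y - x) = q (x - y)"
        using scale[of "- 1" "x - y"] by simp
      ultimately show ?case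
        using elim by (simp add: dist_real_def)
    qed
  qed
  then show ?thesis
    using nonneg add scale by (simp add: continuous_seminorm_def continuous_on_def)
qed

text \<open>\<open>q\<close> is the Minkowski gauge of a convex neighbourhood \<open>V\<close> of 0.
  Intersecting \<open>V0\<close> with its reflection makes \<open>V\<close> symmetric, which is what
  turns positive homogeneity into homogeneity with \<open>\<bar>c\<bar>\<close>.\<close>

lemma continuous_seminorm_nhds_zero:
  fixes U :: "'a::locally_convex_space set"
  assumes "open U" "0 \<in> U"
  obtains q where "continuous_seminorm q" "\<And>x. q x < 1 \<Longrightarrow> x \<in> U"
proof -
  obtain V0 where V0: "open V0" "0 \<in> V0" "V0 \<subseteq> U"
    and V0_convex: "\<And>x y u v. x \<in> V0 \<Longrightarrow> y \<in> V0 \<Longrightarrow> 0 \<le> u \<Longrightarrow> 0 \<le> v \<Longrightarrow> u + v = 1 \<Longrightarrow>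
      u *\<^sub>R x + v *\<^sub>R y \<in> V0"
    using locally_convex[OF assms] by (metis (lifting))
  define V where "V = V0 \<inter> uminus -` V0"
  have "open V"
    unfolding V_def using V0(1)
    by (intro open_Int open_vimage continuous_on_minus continuous_on_id)
  have V: "0 \<in> V" "V \<subseteq> U" "\<And>x. x \<in> V \<Longrightarrow> - x \<in> V"
    using V0 by (auto simp: V_def)
  have V_convex: "u *\<^sub>R x + v *\<^sub>R y \<in> V" if "x \<in> V" "y \<in> V" "0 \<le> u" "0 \<le> v" "u + v = 1" for x y u v
    using V0_convex[of x y u v] V0_convex[of "- x" "- y" u v] that by (simp add: V_def)
  have V_shrink: "c *\<^sub>R x \<in> V" if "x \<in> V" "0 \<le> c" "c \<le> 1" for c x
    using V_convex[OF that(1) V(1), of c "1 - c"] that by simp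
  define q where "q x = Inf {r. 0 < r \<and> inverse r *\<^sub>R x \<in> V}" for x
  \<comment> \<open>\<open>V\<close> is absorbing, by continuity of scalar multiplication in the
    scalar at 0.\<close>
  have ne: "{r. 0 < r \<and> inverse r *\<^sub>R x \<in> V} \<noteq> {}" for x
  proof -
    have "((\<lambda>n. inverse (real (Suc n)) *\<^sub>R x) \<longlongrightarrow> 0 *\<^sub>R x) sequentially"
      by (intro tendsto_scaleR_lcs tendsto_const LIMSEQ_inverse_real_of_nat)
    then have "\<forall>\<^sub>F n in sequentially. inverse (real (Suc n)) *\<^sub>R x \<in> V"
      using \<open>open V\<close> V(1) by (auto dest: topological_tendstoD)
    then obtain n where "inverse (real (Suc n)) *\<^sub>R x \<in> V"
      by (auto simp: eventually_sequentially)
    then show ?thesis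
      by (auto intro!: exI[of _ "real (Suc n)"])
  qed
  have bdd: "bdd_below {r. 0 < r \<and> inverse r *\<^sub>R x \<in> V}" for x
    by (auto simp: bdd_below_def intro!: exI[of _ 0] less_imp_le)
  have q_le: "q x \<le> r" if "0 < r" "inverse r *\<^sub>R x \<in> V" for r x
    unfolding q_def using that bdd by (intro cInf_lower) auto
  have q_nonneg: "0 \<le> q x" for x
    unfolding q_def using ne by (intro cInf_greatest) (auto intro: less_imp_le)
  \<comment> \<open>Some admissible \<open>s\<close> lies below \<open>r\<close>; since
    \<open>V\<close> is convex and contains 0, the factor \<open>s / r < 1\<close> does not lead out
    of it.\<close>
  have q_less: "inverse r *\<^sub>R x \<in> V" if r: "q x < r" for r x
  proof -
    obtain s where s: "0 < s" "inverse s *\<^sub>R x \<in> V" "s < r"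
      using r cInf_less_iff[OF ne bdd] unfolding q_def by auto
    then have "(s / r) *\<^sub>R (inverse s *\<^sub>R x) \<in> V"
      by (intro V_shrink[OF s(2)]) simp_all
    moreover have "s / r * inverse s = inverse r"
      using s by (simp add: field_simps)
    ultimately show ?thesis
      by simp
  qed
  have q_add: "q (x + y) \<le> q x + q y" for x y
  proof (rule field_le_epsilon)
    fix e :: real assume "e > 0"
    define r s where "r = q x + e / 2" and "s = q y + e / 2"
    have pos: "0 < r" "0 < s"
      using q_nonneg[of x] q_nonneg[of y] \<open>e > 0\<close> by (auto simp: r_def s_def)
    \<comment> \<open>These weights make the convex combination equal to
      \<open>(x + y) / (r + s)\<close>.\<close>
    have "(r / (r + s)) *\<^sub>R (inverse r *\<^sub>R x) + (s / (r + s)) *\<^sub>R (inverse s *\<^sub>R y) \<in> V"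
      using pos \<open>e > 0\<close>
      by (intro V_convex q_less) (auto simp: r_def s_def add_divide_distrib[symmetric])
    moreover have "r / (r + s) * inverse r = inverse (r + s)" "s / (r + s) * inverse s = inverse (r + s)"
      using pos by (simp_all add: field_simps)
    ultimately have "inverse (r + s) *\<^sub>R (x + y) \<in> V"
      by (simp add: scaleR_add_right)
    then have "q (x + y) \<le> r + s"
      using pos by (intro q_le) auto
    then show "q (x + y) \<le> q x + q y + e"
      by (simp add: r_def s_def)
  qed
  have q_scale_le: "q (c *\<^sub>R x) \<le> \<bar>c\<bar> * q x" if "c \<noteq> 0" for c x
  proof (rule field_le_epsilon)
    fix e :: real assume "e > 0"
    define r where "r = q x + e / \<bar>c\<bar>"
    have "0 < e / \<bar>c\<bar>"
      using \<open>e > 0\<close> that by simp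
    then have r: "0 < r" "inverse r *\<^sub>R x \<in> V"
      using q_nonneg[of x] by (auto simp: r_def intro!: q_less)
    have "inverse (\<bar>c\<bar> * r) * c = inverse r \<or> inverse (\<bar>c\<bar> * r) * c = - inverse r"
      using r that by (cases "c > 0") (auto simp: field_simps)
    then have "inverse (\<bar>c\<bar> * r) *\<^sub>R (c *\<^sub>R x) \<in> V"
      using r(2) V(3)[OF r(2)] by (auto simp del: inverse_mult_distrib)
    then have "q (c *\<^sub>R x) \<le> \<bar>c\<bar> * r"
      using r that by (intro q_le) auto
    then show "q (c *\<^sub>R x) \<le> \<bar>c\<bar> * q x + e"
      using that by (simp add: r_def distrib_left)
  qed
  have q_zero: "q 0 = 0"
  proof (rule antisym[OF field_le_epsilon q_nonneg])
    show "q 0 \<le> 0 + e" if "e > 0" for e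
      using that V(1) by (intro q_le) auto
  qed
  have q_scale: "q (c *\<^sub>R x) = \<bar>c\<bar> * q x" for c x
  proof (cases "c = 0")
    case True
    then show ?thesis
      by (simp add: q_zero)
  next
    case False
    have "q x \<le> \<bar>inverse c\<bar> * q (c *\<^sub>R x)"
      using q_scale_le[of "inverse c" "c *\<^sub>R x"] False by simp
    then have "\<bar>c\<bar> * q x \<le> q (c *\<^sub>R x)"
      using False by (simp add: field_simps abs_inverse)
    with q_scale_le[OF False] show ?thesis
      by (rule antisym)
  qed
  have "continuous_seminorm q"
  proof (rule seminorm_continuous_at_zero[OF q_nonneg q_add q_scale \<open>open V\<close> V(1)])
    show "q x \<le> 1" if "x \<in> V" for x
      using that by (intro q_le) auto
  qed
  moreover have "x \<in> U" if "q x < 1" for x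
    using q_less[OF that] V(2) by auto
  ultimately show thesis
    by (rule that)
qed

text \<open>The uniformity is pulled back from the neighbourhoods of 0 along differences, and each
  such neighbourhood contains the open unit ball of a continuous seminorm.\<close>

lemma Cauchy_if_seminorm_Cauchy:
  fixes X :: "nat \<Rightarrow> 'a::locally_convex_space"
  assumes "\<And>q e. continuous_seminorm q \<Longrightarrow> 0 < e \<Longrightarrow> \<exists>N. \<forall>m\<ge>N. \<forall>n\<ge>N. q (X m - X n) < e"
  shows "Cauchy X"
  unfolding Cauchy_uniform_iff cauchy_seq_finset_iff_vanishing
proof (intro allI impI)
  fix P :: "'a \<times> 'a \<Rightarrow> bool"
  assume "eventually P (filtercomap (\<lambda>(x, y). y - x) (nhds 0))"
  then obtain Q where Q: "eventually Q (nhds 0)" "\<And>x y. Q (y - x) \<Longrightarrow> P (x, y)"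
    by (auto simp: eventually_filtercomap)
  then obtain U where U: "open U" "0 \<in> U" "\<And>x. x \<in> U \<Longrightarrow> Q x"
    by (auto simp: eventually_nhds)
  obtain q where q: "continuous_seminorm q" "\<And>x. q x < 1 \<Longrightarrow> x \<in> U"
    using continuous_seminorm_nhds_zero[OF U(1,2)] by blast
  obtain N where "\<forall>m\<ge>N. \<forall>n\<ge>N. q (X m - X n) < 1"
    using assms[OF q(1), of 1] by auto
  then show "\<exists>N. \<forall>n\<ge>N. \<forall>m\<ge>N. P (X n, X m)"
    using q(2) U(3) Q(2) by blast
qed

lemma Hahn_Banach_seminorm:
  fixes q :: "'a::locally_convex_space \<Rightarrow> real"
  assumes q: "continuous_seminorm q"
  obtains f where "linear f" "\<And>x. \<bar>f x\<bar> \<le> q x" "f z = q z"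
proof -
  obtain f where f: "linear f" "\<And>x. f x \<le> q x" "f z = q z"
    using Hahn_Banach_sublinear[OF seminorm_sublinear[OF q]] by blast
  have "\<bar>f x\<bar> \<le> q x" for x
    using f(2)[of x] f(2)[of "- x"] linear_neg[OF f(1), of x] continuous_seminormD(6)[OF q, of x]
    by simp
  with f show thesis
    by (intro that)
qed

lemma continuous_on_linear_le_seminorm:
  fixes q :: "'a::locally_convex_space \<Rightarrow> real"
  assumes q: "continuous_seminorm q" and f: "linear f" "\<And>x. \<bar>f x\<bar> \<le> q x"
  shows "continuous_on UNIV f"
proof -
  have "(f \<longlongrightarrow> f y) (at y)" for y
  proof (rule Lim_null_comparison[THEN Lim_null[THEN iffD2]])
    have "((\<lambda>x. q (x - y)) \<longlongrightarrow> q (y - y)) (at y)"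
      using continuous_on_seminorm_diff[OF q continuous_on_id continuous_on_const, of UNIV y]
      unfolding continuous_on_def by blast
    then show "((\<lambda>x. q (x - y)) \<longlongrightarrow> 0) (at y)"
      by (simp add: continuous_seminormD[OF q])
    show "\<forall>\<^sub>F x in at y. norm (f x - f y) \<le> q (x - y)"
      using f by (simp add: linear_diff[symmetric])
  qed
  then show ?thesis
    by (simp add: continuous_on_def)
qed

text \<open>Separation of points enters here: a neighbourhood of 0 that misses \<open>x - y\<close>
  gives a seminorm with \<open>q (x - y) \<ge> 1\<close>, and a norming functional then
  distinguishes the points. This is the source of uniqueness of Pettis integrals.\<close>

lemma continuous_functionals_separate:
  fixes x y :: "'a::{locally_convex_space,t2_space}"
  assumes "\<And>f. linear f \<Longrightarrow> continuous_on UNIV f \<Longrightarrow> f x = (f y :: real)"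
  shows "x = y"
proof (rule ccontr)
  assume "x \<noteq> y"
  then have "x - y \<noteq> 0"
    by simp
  then obtain U where U: "open U" "0 \<in> U" "x - y \<notin> U"
    using t1_space[of 0 "x - y"] by metis
  obtain q where q: "continuous_seminorm q" "\<And>x. q x < 1 \<Longrightarrow> x \<in> U"
    using continuous_seminorm_nhds_zero[OF U(1,2)] by blast
  obtain f where f: "linear f" "\<And>x. \<bar>f x\<bar> \<le> q x" "f (x - y) = q (x - y)"
    using Hahn_Banach_seminorm[OF q(1)] by blast
  have "f x = f y"
    by (intro assms f(1) continuous_on_linear_le_seminorm[OF q(1) f(1,2)])
  then have "q (x - y) = 0"
    using f(3) by (simp add: linear_diff[OF f(1)])
  then show False
    using q(2) U(3) by auto
qed

text \<open>A functional \<open>I\<close> on the dual, thought of as an element of the bidual, is represented by a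
  point as soon as it is approximated by points uniformly on each polar of a seminorm.\<close>
lemma represented_functional:
  fixes X :: "nat \<Rightarrow> 'a::locally_convex_space" and I :: "('a \<Rightarrow> real) \<Rightarrow> real"
  assumes complete: "sequentially_complete TYPE('a)"
    and approx: "\<And>q e. continuous_seminorm q \<Longrightarrow> 0 < e \<Longrightarrow>
      \<exists>N. \<forall>n\<ge>N. \<forall>f. linear f \<and> (\<forall>x. \<bar>f x\<bar> \<le> q x) \<longrightarrow> \<bar>f (X n) - I f\<bar> \<le> e"
  shows "\<exists>z. \<forall>f. linear f \<and> continuous_on UNIV f \<longrightarrow> f z = I f"
proof -
  have "Cauchy X"
  proof (rule Cauchy_if_seminorm_Cauchy)
    fix q :: "'a \<Rightarrow> real" and e :: real
    assume q: "continuous_seminorm q" and "0 < e"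
    then obtain N where N: "\<And>n f. n \<ge> N \<Longrightarrow> linear f \<Longrightarrow> (\<forall>x. \<bar>f x\<bar> \<le> q x) \<Longrightarrow> \<bar>f (X n) - I f\<bar> \<le> e / 3"
      using approx[OF q, of "e / 3"] by auto
    have "q (X m - X n) < e" if "m \<ge> N" "n \<ge> N" for m n
    proof -
      \<comment> \<open>The norming functional depends on \<open>m\<close> and \<open>n\<close>,
        which is why the approximation has to be uniform over the polar.\<close>
      obtain f where f: "linear f" "\<And>x. \<bar>f x\<bar> \<le> q x" "f (X m - X n) = q (X m - X n)"
        using Hahn_Banach_seminorm[OF q] by blast
      have "q (X m - X n) = f (X m) - f (X n)"
        using f by (simp add: linear_diff)
      then show ?thesis
        using N[OF that(1) f(1) allI[OF f(2)]] N[OF that(2) f(1) allI[OF f(2)]] \<open>0 < e\<close> by linarith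
    qed
    then show "\<exists>N. \<forall>m\<ge>N. \<forall>n\<ge>N. q (X m - X n) < e"
      by blast
  qed
  then obtain z where z: "X \<longlonglongrightarrow> z"
    using complete by (auto simp: sequentially_complete_def convergent_def)
  have "f z = I f" if f: "linear f" "continuous_on UNIV f" for f
  proof -
    have "(\<lambda>n. f (X n)) \<longlonglongrightarrow> f z"
      using continuous_on_tendsto_compose[OF f(2) z] by simp
    moreover have "(\<lambda>n. f (X n)) \<longlonglongrightarrow> I f"
    proof (rule LIMSEQ_I)
      \<comment> \<open>The seminorm \<open>\<bar>f\<bar>\<close> has \<open>f\<close> in its polar,
        so the uniform estimate applies to \<open>f\<close> itself.\<close>
      fix r :: real assume "r > 0"
      then show "\<exists>N. \<forall>n\<ge>N. norm (f (X n) - I f) < r"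
        using approx[OF continuous_seminorm_abs_linear[OF f], of "r / 2"] f(1)
        by (fastforce simp: abs_le_iff)
    qed
    ultimately show ?thesis
      by (rule LIMSEQ_unique)
  qed
  then show ?thesis
    by blast
qed

subsection \<open>Lusin measurability\<close>

lemma integrable_lebesgue_on_subset:
  fixes f :: "'a::euclidean_space \<Rightarrow> 'b::{banach, second_countable_topology}"
  assumes "integrable (lebesgue_on T) f" "S \<subseteq> T" "S \<in> sets lebesgue" "T \<in> sets lebesgue"
  shows "integrable (lebesgue_on S) f"
proof -
  have "set_integrable lebesgue T f"
    using assms by (simp add: set_integrable_def integrable_restrict_space)
  then have "set_integrable lebesgue S f"
    by (rule set_integrable_subset) (use assms in auto)
  then show ?thesis
    using assms by (simp add: set_integrable_def integrable_restrict_space)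
qed

lemma compact_sets_lebesgue: "compact K \<Longrightarrow> K \<in> sets lebesgue"
  by (rule fmeasurableD[OF lmeasurable_compact])

lemma lusin_measurable_compose:
  assumes "lusin_measurable \<gamma>" "continuous_on UNIV g"
  shows "lusin_measurable (\<lambda>t. g (\<gamma> t))"
  unfolding lusin_measurable_def
proof (intro allI impI)
  fix e :: real assume "e > 0"
  then obtain K where K: "compact K" "K \<subseteq> {0..1}" "measure lebesgue ({0..1} - K) \<le> e" "continuous_on K \<gamma>"
    using assms(1) unfolding lusin_measurable_def by blast
  moreover have "continuous_on K (\<lambda>t. g (\<gamma> t))"
    using assms(2) K(4) by (rule continuous_on_compose2) auto
  ultimately show "\<exists>K. compact K \<and> K \<subseteq> {0..1} \<and> measure lebesgue ({0..1} - K) \<le> e \<and>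
      continuous_on K (\<lambda>t. g (\<gamma> t))"
    by blast
qed

text \<open>The sets for the two functions at level \<open>e / 2\<close> are intersected. Leaving
  \<open>\<zeta>\<close> abstract lets sums, differences and scalar multiples share this
  argument.\<close>

lemma lusin_measurable_combine:
  assumes "lusin_measurable \<gamma>" "lusin_measurable \<eta>"
    and "\<And>K. continuous_on K \<gamma> \<Longrightarrow> continuous_on K \<eta> \<Longrightarrow> continuous_on K \<zeta>"
  shows "lusin_measurable \<zeta>"
  unfolding lusin_measurable_def
proof (intro allI impI)
  fix e :: real assume "e > 0"
  then obtain K L where K: "compact K" "K \<subseteq> {0..1}" "measure lebesgue ({0..1} - K) \<le> e / 2" "continuous_on K \<gamma>"
    and L: "compact L" "L \<subseteq> {0..1}" "measure lebesgue ({0..1} - L) \<le> e / 2" "continuous_on L \<eta>"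
    using assms(1,2) unfolding lusin_measurable_def by (meson half_gt_zero)
  have sets: "K \<in> sets lebesgue" "L \<in> sets lebesgue"
    using K(1) L(1) by (simp_all add: compact_sets_lebesgue)
  have "{0..1} - K \<inter> L = ({0..1} - K) \<union> ({0..1} - L)"
    by blast
  then have "measure lebesgue ({0..1} - K \<inter> L) \<le> measure lebesgue ({0..1} - K) + measure lebesgue ({0..1} - L)"
    using measure_Un_le[of "{0..1} - K" lebesgue "{0..1} - L"] sets by (simp add: sets.Diff)
  also have "\<dots> \<le> e"
    using K L by simp
  finally show "\<exists>K. compact K \<and> K \<subseteq> {0..1} \<and> measure lebesgue ({0..1} - K) \<le> e \<and> continuous_on K \<zeta>"
    using K L assms(3)[of "K \<inter> L"]
    by (intro exI[of _ "K \<inter> L"]) (auto intro: compact_Int continuous_on_subset)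
qed

lemma lusin_measurable_const: "lusin_measurable (\<lambda>t. c)"
  unfolding lusin_measurable_def by (auto intro!: exI[of _ "{0..1}"])

lemma lusin_measurable_add:
  fixes \<gamma> :: "real \<Rightarrow> 'a::locally_convex_space"
  shows "lusin_measurable \<gamma> \<Longrightarrow> lusin_measurable \<eta> \<Longrightarrow> lusin_measurable (\<lambda>t. \<gamma> t + \<eta> t)"
  by (erule (1) lusin_measurable_combine) (rule continuous_on_add)

lemma lusin_measurable_diff:
  fixes \<gamma> :: "real \<Rightarrow> 'a::locally_convex_space"
  shows "lusin_measurable \<gamma> \<Longrightarrow> lusin_measurable \<eta> \<Longrightarrow> lusin_measurable (\<lambda>t. \<gamma> t - \<eta> t)"
  by (erule (1) lusin_measurable_combine) (rule continuous_on_diff)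

lemma lusin_measurable_scaleR:
  fixes \<gamma> :: "real \<Rightarrow> 'a::locally_convex_space"
  shows "lusin_measurable f \<Longrightarrow> lusin_measurable \<gamma> \<Longrightarrow> lusin_measurable (\<lambda>t. f t *\<^sub>R \<gamma> t)"
  by (erule (1) lusin_measurable_combine) (rule continuous_on_scaleR_lcs)

lemma lusin_measurable_sum:
  fixes \<gamma> :: "'i \<Rightarrow> real \<Rightarrow> 'a::locally_convex_space"
  assumes "\<And>i. i \<in> I \<Longrightarrow> lusin_measurable (\<gamma> i)"
  shows "lusin_measurable (\<lambda>t. \<Sum>i\<in>I. \<gamma> i t)"
  using assms by (induction I rule: infinite_finite_induct)
    (auto intro: lusin_measurable_const lusin_measurable_add)

text \<open>Inner approximation of \<open>S\<close> and of its complement in the unit interval gives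
  two disjoint closed sets. The indicator is constant on each of them, hence continuous on their
  union.\<close>

lemma lusin_measurable_indicator:
  assumes S: "S \<in> sets lebesgue"
  shows "lusin_measurable (indicat_real S)"
  unfolding lusin_measurable_def
proof (intro allI impI)
  fix e :: real assume "e > 0"
  have inner: "\<exists>T. closed T \<and> T \<subseteq> A \<and> A - T \<in> lmeasurable \<and> measure lebesgue (A - T) \<le> e / 2"
    if A: "A \<in> sets lebesgue" for A :: "real set"
  proof -
    have "0 < e / 2"
      using \<open>e > 0\<close> by simp
    then obtain T where "closed T" "T \<subseteq> A" "A - T \<in> lmeasurable" "emeasure lebesgue (A - T) < ennreal (e / 2)"
      using sets_lebesgue_inner_closed[OF A] by blast
    then show ?thesis
      using \<open>e > 0\<close> by (auto simp: emeasure_eq_measure2 ennreal_less_iff intro!: exI[of _ T])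
  qed
  obtain T1 where T1: "closed T1" "T1 \<subseteq> {0..1} \<inter> S" "{0..1} \<inter> S - T1 \<in> lmeasurable"
      "measure lebesgue ({0..1} \<inter> S - T1) \<le> e / 2"
    using inner[OF sets.Int[OF _ S], of "{0..1}"] by auto
  obtain T2 where T2: "closed T2" "T2 \<subseteq> {0..1} - S" "{0..1} - S - T2 \<in> lmeasurable"
      "measure lebesgue ({0..1} - S - T2) \<le> e / 2"
    using inner[OF sets.Diff[OF _ S], of "{0..1}"] by auto
  have "{0..1} - (T1 \<union> T2) = ({0..1} \<inter> S - T1) \<union> ({0..1} - S - T2)"
    using T1(2) T2(2) by auto
  then have "measure lebesgue ({0..1} - (T1 \<union> T2)) \<le> e"
    using measure_Un_le[of "{0..1} \<inter> S - T1" lebesgue "{0..1} - S - T2"] T1(3,4) T2(3,4)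
    by (simp add: fmeasurableD)
  moreover have "compact (T1 \<union> T2)" "T1 \<union> T2 \<subseteq> {0..1}"
    using T1(1,2) T2(1,2) by (auto simp: compact_eq_bounded_closed intro: bounded_subset[of "{0..1}"])
  moreover have "continuous_on (T1 \<union> T2) (indicat_real S)"
  proof (rule continuous_on_closed_Un[OF T1(1) T2(1)])
    show "continuous_on T1 (indicat_real S)"
      using continuous_on_const[of T1 "1::real"] by (rule continuous_on_eq) (use T1(2) in auto)
    show "continuous_on T2 (indicat_real S)"
      using continuous_on_const[of T2 "0::real"] by (rule continuous_on_eq) (use T2(2) in auto)
  qed
  ultimately show "\<exists>K. compact K \<and> K \<subseteq> {0..1} \<and> measure lebesgue ({0..1} - K) \<le> e \<and>
      continuous_on K (indicat_real S)"
    by blast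
qed

text \<open>A finite union of compact sets on which \<open>\<gamma>\<close> is continuous is again such a set, so the
  exhausting sequence may be chosen increasing.\<close>
lemma lusin_measurable_exhaustion:
  assumes "lusin_measurable \<gamma>"
  obtains K :: "nat \<Rightarrow> real set" where "\<And>n. compact (K n)" "\<And>n. K n \<subseteq> {0..1}" "incseq K"
    "\<And>n. continuous_on (K n) \<gamma>" "negligible ({0..1} - (\<Union>n. K n))"
proof -
  have "\<exists>K. compact K \<and> K \<subseteq> {0..1} \<and> measure lebesgue ({0..1} - K) \<le> inverse (real (Suc n)) \<and>
      continuous_on K \<gamma>" for n
    using assms unfolding lusin_measurable_def by simp
  then obtain L where L: "\<And>n. compact (L n)" "\<And>n. L n \<subseteq> {0..1}"
      "\<And>n. measure lebesgue ({0..1} - L n) \<le> inverse (real (Suc n))" "\<And>n. continuous_on (L n) \<gamma>"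
    by metis
  define K where "K n = (\<Union>i\<le>n. L i)" for n
  show thesis
  proof (rule that[of K])
    show "compact (K n)" "K n \<subseteq> {0..1}" for n
      using L(1,2) by (auto simp: K_def intro!: compact_UN)
    show "incseq K"
      unfolding incseq_def K_def by (intro allI impI UN_mono) auto
    show "continuous_on (K n) \<gamma>" for n
    proof (induction n)
      case (Suc n)
      have "K (Suc n) = K n \<union> L (Suc n)"
        by (auto simp: K_def le_Suc_eq)
      moreover have "closed (K n)"
        using L(1) by (auto simp: K_def intro!: compact_imp_closed compact_UN)
      ultimately show ?case
        using continuous_on_closed_Un[OF _ compact_imp_closed[OF L(1)] Suc L(4)] by simp
    qed (use L(4) in \<open>simp add: K_def\<close>)
    define N where "N = {0..1} - (\<Union>n. K n)"
    have "{0..1::real} \<in> lmeasurable"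
      by simp
    then have meas: "{0..1} - L n \<in> lmeasurable" for n
      by (rule fmeasurable_Diff) (rule compact_sets_lebesgue[OF L(1)])
    have "(\<Union>n. K n) \<in> sets lebesgue"
      using compact_sets_lebesgue[OF \<open>\<And>n. compact (K n)\<close>] by blast
    with \<open>{0..1::real} \<in> lmeasurable\<close> have N: "N \<in> lmeasurable"
      unfolding N_def by (rule fmeasurable_Diff)
    have "measure lebesgue N \<le> inverse (real (Suc n))" for n
    proof -
      have "measure lebesgue N \<le> measure lebesgue ({0..1} - L n)"
        using N meas by (intro measure_mono_fmeasurable) (auto simp: N_def K_def)
      then show ?thesis
        using L(3)[of n] by simp
    qed
    then have "measure lebesgue N \<le> 0"
      by (intro LIMSEQ_le_const[OF LIMSEQ_inverse_real_of_nat]) auto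
    then show "negligible N"
      using N by (simp add: negligible_iff_measure0 measure_le_0_iff)
  qed
qed

text \<open>The preimage of an open set splits into its parts in the sets \<open>K n\<close>, where
  continuity gives measurability, and a part of a negligible set, which is measurable because
  Lebesgue measure is complete.\<close>

lemma lusin_measurable_imp_borel_measurable:
  fixes \<gamma> :: "real \<Rightarrow> real"
  assumes "lusin_measurable \<gamma>"
  shows "\<gamma> \<in> borel_measurable (lebesgue_on {0..1})"
proof -
  obtain K :: "nat \<Rightarrow> real set" where K: "\<And>n. compact (K n)" "\<And>n. K n \<subseteq> {0..1}"
    "\<And>n. continuous_on (K n) \<gamma>" "negligible ({0..1} - (\<Union>n. K n))"
    using lusin_measurable_exhaustion[OF assms] by metis
  have "{t \<in> {0..1}. \<gamma> t \<in> U} \<in> sets lebesgue" if "open U" for U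
  proof -
    have "{t \<in> K n. \<gamma> t \<in> U} \<in> sets lebesgue" for n
    proof -
      have "K n \<in> sets lebesgue"
        by (rule compact_sets_lebesgue[OF K(1)])
      then show ?thesis
        using continuous_imp_measurable_on_sets_lebesgue[OF K(3)[of n]]
          borel_measurable_vimage_open[of \<gamma> "K n"] \<open>open U\<close>
        by (simp add: sets_restrict_space_iff)
    qed
    then have "(\<Union>n. {t \<in> K n. \<gamma> t \<in> U}) \<in> sets lebesgue"
      by blast
    moreover have "{t \<in> {0..1} - (\<Union>n. K n). \<gamma> t \<in> U} \<in> sets lebesgue"
      by (rule negligible_imp_sets[OF negligible_subset[OF K(4)]]) auto
    moreover have "{t \<in> {0..1}. \<gamma> t \<in> U} =
        (\<Union>n. {t \<in> K n. \<gamma> t \<in> U}) \<union> {t \<in> {0..1} - (\<Union>n. K n). \<gamma> t \<in> U}"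
      using UN_least[of UNIV K, OF K(2)] by blast
    ultimately show ?thesis
      by (simp add: sets.Un)
  qed
  then show ?thesis
    by (subst borel_measurable_vimage_open) (auto simp: sets_restrict_space_iff)
qed

lemma lusin_measurable_seminorm:
  assumes "lusin_measurable \<gamma>" "continuous_seminorm q"
  shows "(\<lambda>t. q (\<gamma> t)) \<in> borel_measurable (lebesgue_on {0..1})"
  using lusin_measurable_compose[OF assms(1) continuous_seminormD(4)[OF assms(2)]]
  by (rule lusin_measurable_imp_borel_measurable)

subsection \<open>Power means and Minkowski's inequality\<close>

text \<open>Lusin measurability of \<open>\<gamma>\<close> already makes
  \<open>q (\<gamma> t)\<close> measurable, and seminorms are nonnegative, so only integrability of
  the power remains to be checked.\<close>

lemma Lp_fun_iff:
  "\<gamma> \<in> Lp_fun p \<longleftrightarrow> lusin_measurable \<gamma> \<and>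
    (\<forall>q. continuous_seminorm q \<longrightarrow> integrable (lebesgue_on {0..1}) (\<lambda>t. q (\<gamma> t) powr p))"
proof -
  have "q \<circ> \<gamma> \<in> Lp_fun_real p \<longleftrightarrow> integrable (lebesgue_on {0..1}) (\<lambda>t. q (\<gamma> t) powr p)"
    if "lusin_measurable \<gamma>" "continuous_seminorm q" for q
    using lusin_measurable_seminorm[OF that] continuous_seminormD(1)[OF that(2)]
    by (simp add: Lp_fun_real_def comp_def)
  then show ?thesis
    by (auto simp: Lp_fun_def)
qed

text \<open>The sum is at most twice the maximum. The constant is crude, but it serves integrability
  proofs and limits equally well.\<close>

lemma add_powr_le:
  fixes x y p :: real
  assumes "0 \<le> x" "0 \<le> y" "0 \<le> p"
  shows "(x + y) powr p \<le> 2 powr p * (x powr p + y powr p)"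
proof -
  have "(x + y) powr p \<le> (2 * max x y) powr p"
    using assms by (intro powr_mono2) auto
  also have "\<dots> = 2 powr p * max x y powr p"
    using assms by (simp add: powr_mult)
  also have "\<dots> \<le> 2 powr p * (x powr p + y powr p)"
    by (intro mult_left_mono) (auto simp: max_def)
  finally show ?thesis .
qed

lemma Lp_fun_diff:
  fixes \<gamma> :: "real \<Rightarrow> 'a::locally_convex_space"
  assumes "\<gamma> \<in> Lp_fun p" "\<eta> \<in> Lp_fun p" "0 \<le> p"
  shows "(\<lambda>t. \<gamma> t - \<eta> t) \<in> Lp_fun p"
  unfolding Lp_fun_iff
proof (intro conjI allI impI)
  show lusin: "lusin_measurable (\<lambda>t. \<gamma> t - \<eta> t)"
    using assms by (auto simp: Lp_fun_iff intro: lusin_measurable_diff)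
  fix q :: "'a \<Rightarrow> real" assume q: "continuous_seminorm q"
  show "integrable (lebesgue_on {0..1}) (\<lambda>t. q (\<gamma> t - \<eta> t) powr p)"
  proof (rule Bochner_Integration.integrable_bound)
    show "integrable (lebesgue_on {0..1}) (\<lambda>t. 2 powr p * (q (\<gamma> t) powr p + q (\<eta> t) powr p))"
      using assms q by (auto simp: Lp_fun_iff)
    show "(\<lambda>t. q (\<gamma> t - \<eta> t) powr p) \<in> borel_measurable (lebesgue_on {0..1})"
      using lusin_measurable_seminorm[OF lusin q] by measurable
    have "q (x - y) powr p \<le> 2 powr p * (q x powr p + q y powr p)" for x y
    proof -
      have "q (x - y) powr p \<le> (q x + q y) powr p"
        using assms(3) by (intro powr_mono2 continuous_seminorm_diff_le[OF q] continuous_seminormD(1)[OF q])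
      also have "\<dots> \<le> 2 powr p * (q x powr p + q y powr p)"
        using assms(3) by (intro add_powr_le continuous_seminormD(1)[OF q])
      finally show ?thesis .
    qed
    then show "AE t in lebesgue_on {0..1}. norm (q (\<gamma> t - \<eta> t) powr p) \<le>
        norm (2 powr p * (q (\<gamma> t) powr p + q (\<eta> t) powr p))"
      by (auto intro!: AE_I2)
  qed
qed

lemma Lp_fun_imp_L1:
  assumes "\<gamma> \<in> Lp_fun p" "1 \<le> p" "continuous_seminorm q"
  shows "integrable (lebesgue_on {0..1}) (\<lambda>t. q (\<gamma> t))"
proof (rule Bochner_Integration.integrable_bound)
  show "integrable (lebesgue_on {0..1}) (\<lambda>t. 1 + q (\<gamma> t) powr p)"
    using assms by (auto simp: Lp_fun_iff integrable_const_ivl)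
  show "(\<lambda>t. q (\<gamma> t)) \<in> borel_measurable (lebesgue_on {0..1})"
    using assms by (intro lusin_measurable_seminorm) (auto simp: Lp_fun_iff)
  have "x \<le> 1 + x powr p" if "0 \<le> x" for x :: real
  proof (cases "x \<le> 1")
    case False
    then show ?thesis
      using powr_mono[OF \<open>1 \<le> p\<close>, of x] by simp
  qed (simp add: add_increasing2)
  then show "AE t in lebesgue_on {0..1}. norm (q (\<gamma> t)) \<le> norm (1 + q (\<gamma> t) powr p)"
    using continuous_seminormD(1)[OF assms(3)] by (auto intro!: AE_I2)
qed

text \<open>Convexity on the open half-line gives the case \<open>x > 0\<close>. At
  \<open>x = 0\<close> the tangent has the value \<open>(1 - p) * a powr p\<close>, which is at most
  0.\<close>

lemma powr_above_tangent:
  fixes a x p :: real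
  assumes "0 < a" "0 \<le> x" "1 \<le> p"
  shows "a powr p + p * a powr (p - 1) * (x - a) \<le> x powr p"
proof (cases "x = 0")
  case True
  have "a powr (p - 1) * a = a powr p"
    using assms by (simp add: powr_diff)
  moreover have "a powr p \<le> p * a powr p"
    using assms(3) mult_right_mono[of 1 p "a powr p"] by simp
  ultimately show ?thesis
    using True assms by (simp add: mult.assoc)
next
  case False
  have "p * a powr (p - 1) * (x - a) \<le> x powr p - a powr p"
    using assms False
    by (intro convex_on_imp_above_tangent[where A = "{0<..}"] powr_convex)
      (auto simp: interior_open intro!: derivative_eq_intros)
  then show ?thesis
    by simp
qed

text \<open>The tangent is taken at the combination \<open>c\<close>; weighting its values at
  \<open>x\<close> and \<open>y\<close> cancels the linear terms. The points \<open>x\<close> and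
  \<open>y\<close> may be 0, as Minkowski's inequality requires.\<close>

lemma powr_convex_combination:
  fixes x y u v p :: real
  assumes "0 \<le> x" "0 \<le> y" "0 \<le> u" "0 \<le> v" "u + v = 1" "1 \<le> p"
  shows "(u * x + v * y) powr p \<le> u * x powr p + v * y powr p"
proof (cases "u * x + v * y = 0")
  case False
  define c where "c = u * x + v * y"
  have "0 < c"
    using False assms by (simp add: c_def order_less_le)
  define d where "d = p * c powr (p - 1)"
  have "u * (c powr p + d * (x - c)) + v * (c powr p + d * (y - c)) \<le> u * x powr p + v * y powr p"
    unfolding d_def using assms \<open>0 < c\<close> by (intro add_mono mult_left_mono powr_above_tangent)
  moreover have "u * (c powr p + d * (x - c)) + v * (c powr p + d * (y - c)) =
      (u + v) * c powr p + d * (u * x + v * y - (u + v) * c)"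
    by (simp add: algebra_simps)
  ultimately show ?thesis
    using assms(5) by (simp add: c_def)
qed (use assms in simp)

text \<open>Integrate the tangent inequality at the mean \<open>a\<close>: the linear term has
  integral 0. A mean of 0 is treated apart, because the tangent is used only at positive
  points.\<close>

lemma (in finite_measure) Jensen_powr:
  fixes h :: "'a \<Rightarrow> real"
  assumes "integrable M h" "integrable M (\<lambda>t. h t powr p)" "\<And>t. 0 \<le> h t" "1 \<le> p"
    and m: "0 < measure M (space M)"
  shows "((LINT t|M. h t) / measure M (space M)) powr p \<le> (LINT t|M. h t powr p) / measure M (space M)"
proof -
  define m where "m = measure M (space M)"
  define a where "a = (LINT t|M. h t) / m"
  have "0 < m"
    using m by (simp add: m_def)
  have "0 \<le> a"
    using assms(3) \<open>0 < m\<close> by (simp add: a_def)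
  show ?thesis
  proof (cases "a = 0")
    case True
    then show ?thesis
      using assms by (simp add: a_def m_def)
  next
    case False
    then have "0 < a"
      using \<open>0 \<le> a\<close> by simp
    have "(LINT t|M. a powr p + p * a powr (p - 1) * (h t - a)) \<le> (LINT t|M. h t powr p)"
      using assms \<open>0 < a\<close> by (intro integral_mono powr_above_tangent) auto
    moreover have "(LINT t|M. a powr p + p * a powr (p - 1) * (h t - a)) =
        m * a powr p + p * a powr (p - 1) * ((LINT t|M. h t) - m * a)"
      using assms by (simp add: m_def)
    moreover have "(LINT t|M. h t) - m * a = 0"
      using \<open>0 < m\<close> by (simp add: a_def)
    ultimately have "m * a powr p \<le> (LINT t|M. h t powr p)"
      by simp
    then show ?thesis
      using \<open>0 < m\<close> by (simp add: a_def m_def field_simps)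
  qed
qed

text \<open>After division by \<open>a\<close> and \<open>b\<close> both functions have norm at most
  1, and \<open>(f + g) / (a + b)\<close> is a convex combination of them with weights
  \<open>u\<close> and \<open>v\<close>.\<close>

lemma Minkowski_powr:
  fixes f g :: "'a \<Rightarrow> real"
  assumes f: "integrable M (\<lambda>t. f t powr p)" "f \<in> borel_measurable M" "\<And>t. 0 \<le> f t"
    and g: "integrable M (\<lambda>t. g t powr p)" "g \<in> borel_measurable M" "\<And>t. 0 \<le> g t"
    and p: "1 \<le> p"
  shows "(LINT t|M. (f t + g t) powr p) powr (1 / p) \<le>
    (LINT t|M. f t powr p) powr (1 / p) + (LINT t|M. g t powr p) powr (1 / p)"
proof (rule field_le_epsilon)
  fix e :: real assume "e > 0"
  \<comment> \<open>The slack \<open>e / 2\<close> keeps \<open>a\<close> and \<open>b\<close>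
    positive even when a norm vanishes.\<close>
  define a where "a = (LINT t|M. f t powr p) powr (1 / p) + e / 2"
  define b where "b = (LINT t|M. g t powr p) powr (1 / p) + e / 2"
  have pos: "0 < a" "0 < b"
    using \<open>e > 0\<close> by (auto simp: a_def b_def intro: add_nonneg_pos)
  have le: "(LINT t|M. h t powr p) \<le> c powr p"
    if "c = (LINT t|M. h t powr p) powr (1 / p) + e / 2" for h :: "'a \<Rightarrow> real" and c
  proof -
    have "(LINT t|M. h t powr p) = ((LINT t|M. h t powr p) powr (1 / p)) powr p"
      using p by (simp add: powr_powr)
    also have "\<dots> \<le> c powr p"
      using that \<open>e > 0\<close> p by (intro powr_mono2) auto
    finally show ?thesis .
  qed
  define u v where "u = a / (a + b)" and "v = b / (a + b)"
  have uv: "0 \<le> u" "0 \<le> v" "u + v = 1"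
    using pos by (simp_all add: u_def v_def add_divide_distrib[symmetric])
  have pointwise: "(f t + g t) powr p \<le>
      (a + b) powr p * (u * (f t powr p / a powr p) + v * (g t powr p / b powr p))" for t
  proof -
    have "f t + g t = (a + b) * (u * (f t / a) + v * (g t / b))"
      using pos by (simp add: u_def v_def divide_simps)
    then have "(f t + g t) powr p = (a + b) powr p * (u * (f t / a) + v * (g t / b)) powr p"
      using pos f(3) g(3) uv by (simp add: powr_mult)
    also have "\<dots> \<le> (a + b) powr p * (u * (f t / a) powr p + v * (g t / b) powr p)"
      using pos f(3) g(3) uv p by (intro mult_left_mono powr_convex_combination) auto
    finally show ?thesis
      using pos f(3) g(3) by (simp add: powr_divide)
  qed
  have "(LINT t|M. (f t + g t) powr p) \<le>
      (LINT t|M. (a + b) powr p * (u * (f t powr p / a powr p) + v * (g t powr p / b powr p)))"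
    using f g pos uv pointwise by (intro integral_mono_AE' AE_I2) simp_all
  also have "\<dots> = (a + b) powr p *
      (u * ((LINT t|M. f t powr p) / a powr p) + v * ((LINT t|M. g t powr p) / b powr p))"
    using f g by simp
  also have "\<dots> \<le> (a + b) powr p * (u * 1 + v * 1)"
    using pos uv le[OF a_def] le[OF b_def] by (intro mult_left_mono add_mono) auto
  finally have "(LINT t|M. (f t + g t) powr p) \<le> (a + b) powr p"
    using uv by simp
  then have "(LINT t|M. (f t + g t) powr p) powr (1 / p) \<le> ((a + b) powr p) powr (1 / p)"
    using p by (intro powr_mono2) auto
  then show "(LINT t|M. (f t + g t) powr p) powr (1 / p) \<le>
    (LINT t|M. f t powr p) powr (1 / p) + (LINT t|M. g t powr p) powr (1 / p) + e"
    using pos p by (simp add: powr_powr a_def b_def)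
qed

section \<open>Dyadic intervals and additivity of the integral over them\<close>

lemma dyadic_interval_subset: "j \<in> {1..2 ^ n} \<Longrightarrow> dyadic_interval n j \<subseteq> {0..1}"
  by (auto simp: dyadic_interval_def divide_simps)

lemma dyadic_interval_sets [simp]: "dyadic_interval n j \<in> sets lebesgue"
  by (simp add: dyadic_interval_def)

lemma measure_dyadic_interval [simp]: "measure lebesgue (dyadic_interval n j) = 1 / 2 ^ n"
  by (simp add: dyadic_interval_def divide_right_mono diff_divide_distrib)

lemma sum_dyadic_interval_integral:
  fixes h :: "real \<Rightarrow> real"
  assumes h: "integrable (lebesgue_on {0..1}) h"
  shows "(\<Sum>j = 1..2 ^ n. LINT t|lebesgue_on (dyadic_interval n j). h t) = (LINT t|lebesgue_on {0..1}. h t)"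
proof -
  have sub: "integral\<^sup>L (lebesgue_on {a..b}) h = integral {a..b} h" "h integrable_on {a..b}"
    if "0 \<le> a" "b \<le> 1" for a b
  proof -
    have "integrable (lebesgue_on {a..b}) h"
      using that by (intro integrable_lebesgue_on_subset[OF h]) auto
    then show "integral\<^sup>L (lebesgue_on {a..b}) h = integral {a..b} h" "h integrable_on {a..b}"
      by (auto intro: lebesgue_integral_eq_integral integrable_on_lebesgue_on)
  qed
  \<comment> \<open>Induction on the number \<open>k\<close> of initial intervals. Adjacent closed
    intervals share an endpoint, which the gauge integral absorbs when it combines them.\<close>
  have "(\<Sum>j = 1..k. LINT t|lebesgue_on (dyadic_interval n j). h t) =
      (LINT t|lebesgue_on {0..real k / 2 ^ n}. h t)" if "k \<le> 2 ^ n" for k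
    using that
  proof (induction k)
    case 0
    then show ?case
      using sub(1)[of 0 0] by simp
  next
    case (Suc k)
    have le: "real (Suc k) / 2 ^ n \<le> 1"
      using Suc.prems of_nat_le_iff[of "Suc k" "2 ^ n", where 'a = real] by (simp add: divide_le_eq_1)
    have le': "real k / 2 ^ n \<le> real (Suc k) / 2 ^ n"
      by (simp add: divide_right_mono)
    have "integral {0..real k / 2 ^ n} h + integral {real k / 2 ^ n..real (Suc k) / 2 ^ n} h =
        integral {0..real (Suc k) / 2 ^ n} h"
      using le le' by (intro Henstock_Kurzweil_Integration.integral_combine sub) auto
    then show ?case
      using Suc le le' by (simp add: dyadic_interval_def sub)
  qed
  from this[of "2 ^ n"] show ?thesis
    by simp
qed

subsection \<open>Existence of Pettis integrals\<close>

text \<open>Uniform continuity is applied to the real function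
  \<open>q (\<gamma> s - \<gamma> t)\<close> on the compact square: it vanishes on the diagonal, so
  \<open>(s, t)\<close> is compared with \<open>(t, t)\<close>.\<close>

lemma seminorm_uniformly_continuous_on_compact:
  fixes \<gamma> :: "'b::metric_space \<Rightarrow> 'a::locally_convex_space"
  assumes K: "compact K" and \<gamma>: "continuous_on K \<gamma>" and q: "continuous_seminorm q" and "0 < e"
  obtains d where "0 < d" "\<And>s t. s \<in> K \<Longrightarrow> t \<in> K \<Longrightarrow> dist s t < d \<Longrightarrow> q (\<gamma> s - \<gamma> t) < e"
proof -
  have "continuous_on (K \<times> K) (\<lambda>x. \<gamma> (fst x))" "continuous_on (K \<times> K) (\<lambda>x. \<gamma> (snd x))"
    by (auto intro!: continuous_on_compose2[OF \<gamma>] continuous_intros)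
  then have "continuous_on (K \<times> K) (\<lambda>x. q (\<gamma> (fst x) - \<gamma> (snd x)))"
    by (rule continuous_on_seminorm_diff[OF q])
  then have "uniformly_continuous_on (K \<times> K) (\<lambda>x. q (\<gamma> (fst x) - \<gamma> (snd x)))"
    using K by (intro compact_uniformly_continuous compact_Times)
  then obtain d where d: "0 < d" "\<And>x y. x \<in> K \<times> K \<Longrightarrow> y \<in> K \<times> K \<Longrightarrow> dist y x < d \<Longrightarrow>
      dist (q (\<gamma> (fst y) - \<gamma> (snd y))) (q (\<gamma> (fst x) - \<gamma> (snd x))) < e"
    using \<open>0 < e\<close> unfolding uniformly_continuous_on_def by metis
  show thesis
  proof (rule that[OF d(1)])
    fix s t assume "s \<in> K" "t \<in> K" "dist s t < d"
    then show "q (\<gamma> s - \<gamma> t) < e"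
      using d(2)[of "(t, t)" "(s, t)"] continuous_seminormD(1)[OF q, of "\<gamma> s - \<gamma> t"]
      by (simp add: dist_prod_def continuous_seminormD(5)[OF q])
  qed
qed

text \<open>Extension of \<open>g\<close> by zero reduces this to the whole unit interval.\<close>

lemma sum_dyadic_interval_integral_on:
  fixes g :: "real \<Rightarrow> real"
  assumes "integrable (lebesgue_on S) g" "S \<subseteq> {0..1}" "S \<in> sets lebesgue"
  shows "(\<Sum>j = 1..2 ^ n. LINT t|lebesgue_on (S \<inter> dyadic_interval n j). g t) = (LINT t|lebesgue_on S. g t)"
proof -
  have "integrable lebesgue (\<lambda>t. if t \<in> S then g t else 0)"
    using assms(1,3) by (simp add: Lebesgue_Measure.integrable_restrict_UNIV)
  then have "integrable (lebesgue_on {0..1}) (\<lambda>t. if t \<in> S then g t else 0)"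
    using integrable_lebesgue_on_subset[of UNIV "\<lambda>t. if t \<in> S then g t else 0" "{0..1}"]
    by (simp add: lebesgue_on_UNIV_eq)
  from sum_dyadic_interval_integral[OF this, of n] show ?thesis
    using assms by (simp add: Lebesgue_Measure.integral_restrict Lebesgue_Measure.integral_restrict_Int)
qed

lemma continuous_on_compact_integrable:
  fixes g :: "'a::euclidean_space \<Rightarrow> real"
  assumes "compact K" "continuous_on K g"
  shows "integrable (lebesgue_on K) g"
proof -
  interpret finite_measure "lebesgue_on K"
    by (rule finite_measure_lebesgue_on[OF lmeasurable_compact[OF assms(1)]])
  obtain B where "\<forall>x\<in>g ` K. norm x \<le> B"
    using compact_imp_bounded[OF compact_continuous_image[OF assms(2,1)]] bounded_iff by blast
  then show ?thesis
    using continuous_imp_measurable_on_sets_lebesgue[OF assms(2) compact_sets_lebesgue[OF assms(1)]]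
    by (intro integrable_const_bound[of _ B]) (auto intro!: AE_I2)
qed

text \<open>\<open>X n\<close> is a Riemann sum over the pieces
  \<open>K \<inter> dyadic_interval n j\<close>. If \<open>q (\<gamma> s - \<gamma> t) < e\<close>
  whenever \<open>s\<close> and \<open>t\<close> lie in one piece, then every \<open>f\<close> with
  \<open>\<bar>f\<bar> \<le> q\<close> oscillates by at most \<open>e\<close> on it, so the error is
  bounded uniformly in \<open>f\<close>.\<close>

lemma integral_functional_on_compact:
  fixes \<gamma> :: "real \<Rightarrow> 'a::locally_convex_space"
  assumes complete: "sequentially_complete TYPE('a)"
    and K: "compact K" "K \<subseteq> {0..1}" and \<gamma>: "continuous_on K \<gamma>"
  shows "\<exists>z. \<forall>f :: 'a \<Rightarrow> real. linear f \<and> continuous_on UNIV f \<longrightarrow> f z = (LINT t|lebesgue_on K. f (\<gamma> t))"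
proof -
  \<comment> \<open>On an empty piece the tag is arbitrary; its weight in \<open>X n\<close> is then
    0.\<close>
  define \<tau> where "\<tau> n j = (SOME t. t \<in> K \<inter> dyadic_interval n j)" for n j
  define X where "X n = (\<Sum>j = 1..2 ^ n. measure lebesgue (K \<inter> dyadic_interval n j) *\<^sub>R \<gamma> (\<tau> n j))" for n
  have approx: "\<exists>N. \<forall>n\<ge>N. \<forall>f. linear f \<and> (\<forall>x. \<bar>f x\<bar> \<le> q x) \<longrightarrow>
      \<bar>f (X n) - (LINT t|lebesgue_on K. f (\<gamma> t))\<bar> \<le> e"
    if q: "continuous_seminorm q" and "0 < e" for q :: "'a \<Rightarrow> real" and e
  proof -
    obtain d where d: "0 < d" "\<And>s t. s \<in> K \<Longrightarrow> t \<in> K \<Longrightarrow> dist s t < d \<Longrightarrow> q (\<gamma> s - \<gamma> t) < e"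
      using seminorm_uniformly_continuous_on_compact[OF K(1) \<gamma> q \<open>0 < e\<close>] by blast
    obtain N where N: "(1 / 2) ^ N < d"
      using real_arch_pow_inv[OF d(1), of "1 / 2"] by auto
    have "\<bar>f (X n) - (LINT t|lebesgue_on K. f (\<gamma> t))\<bar> \<le> e"
      if "n \<ge> N" and f: "linear f" and f_le: "\<And>x. \<bar>f x\<bar> \<le> q x" for n f
    proof -
      have "continuous_on K (\<lambda>t. f (\<gamma> t))"
        using continuous_on_linear_le_seminorm[OF q f f_le] \<gamma> by (rule continuous_on_compose2) auto
      then have int: "integrable (lebesgue_on K) (\<lambda>t. f (\<gamma> t))"
        by (rule continuous_on_compact_integrable[OF K(1)])
      \<comment> \<open>The bound uses the length of the full interval instead of the measure of the
        piece, so that the \<open>2 ^ n\<close> errors add up to exactly \<open>e\<close>.\<close>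
      have piece: "\<bar>measure lebesgue (K \<inter> dyadic_interval n j) * f (\<gamma> (\<tau> n j)) -
          (LINT t|lebesgue_on (K \<inter> dyadic_interval n j). f (\<gamma> t))\<bar> \<le> e * (1 / 2 ^ n)" for j
      proof -
        define S where "S = K \<inter> dyadic_interval n j"
        have S: "S \<in> sets lebesgue" "S \<in> lmeasurable"
          using K(1) by (auto simp: S_def dyadic_interval_def intro!: lmeasurable_compact compact_Int compact_sets_lebesgue)
        have intS: "integrable (lebesgue_on S) (\<lambda>t. f (\<gamma> t))"
          by (rule integrable_lebesgue_on_subset[OF int]) (use S K(1) compact_sets_lebesgue in \<open>auto simp: S_def\<close>)
        interpret finite_measure "lebesgue_on S"
          using S(2) by (rule finite_measure_lebesgue_on)
        have meas: "measure (lebesgue_on S) (space (lebesgue_on S)) = measure lebesgue S"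
          using S(1) by (simp add: measure_restrict_space space_restrict_space)
        have close: "\<bar>f (\<gamma> (\<tau> n j)) - f (\<gamma> t)\<bar> \<le> e" if "t \<in> S" for t
        proof -
          have \<tau>: "\<tau> n j \<in> K \<inter> dyadic_interval n j"
            unfolding \<tau>_def by (rule someI[of _ t]) (use that in \<open>simp add: S_def\<close>)
          have "\<bar>\<tau> n j - t\<bar> \<le> real j / 2 ^ n - (real j - 1) / 2 ^ n"
            using \<tau> that by (auto simp: S_def dyadic_interval_def)
          also have "\<dots> = (1 / 2) ^ n"
            by (simp add: diff_divide_distrib power_one_over)
          also have "\<dots> \<le> (1 / 2) ^ N"
            using \<open>n \<ge> N\<close> by (intro power_decreasing) auto
          finally have "q (\<gamma> (\<tau> n j) - \<gamma> t) < e"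
            using N \<tau> that by (intro d(2)) (auto simp: S_def dist_real_def)
          then show ?thesis
            using f_le[of "\<gamma> (\<tau> n j) - \<gamma> t"] by (simp add: linear_diff[OF f])
        qed
        have "measure lebesgue S * f (\<gamma> (\<tau> n j)) - (LINT t|lebesgue_on S. f (\<gamma> t)) =
            (LINT t|lebesgue_on S. f (\<gamma> (\<tau> n j)) - f (\<gamma> t))"
          using intS meas by simp
        also have "\<bar>\<dots>\<bar> \<le> (LINT t|lebesgue_on S. \<bar>f (\<gamma> (\<tau> n j)) - f (\<gamma> t)\<bar>)"
          by (rule integral_abs_bound)
        also have "\<dots> \<le> (LINT t|lebesgue_on S. e)"
          using intS close by (intro integral_mono) (auto simp: space_restrict_space)
        also have "\<dots> = e * measure lebesgue S"
          using meas by simp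
        also have "\<dots> \<le> e * measure lebesgue (dyadic_interval n j)"
          using \<open>0 < e\<close> S(1) by (intro mult_left_mono measure_mono_fmeasurable)
            (auto simp: S_def dyadic_interval_def)
        finally show ?thesis
          by (simp add: S_def)
      qed
      have "f (X n) - (LINT t|lebesgue_on K. f (\<gamma> t)) =
          (\<Sum>j = 1..2 ^ n. measure lebesgue (K \<inter> dyadic_interval n j) * f (\<gamma> (\<tau> n j)) -
            (LINT t|lebesgue_on (K \<inter> dyadic_interval n j). f (\<gamma> t)))"
        unfolding X_def sum_subtractf
        using sum_dyadic_interval_integral_on[OF int K(2) compact_sets_lebesgue[OF K(1)], of n]
        by (simp add: linear_sum[OF f] linear_scale[OF f])
      also have "\<bar>\<dots>\<bar> \<le> (\<Sum>j::nat = 1..2 ^ n. e * (1 / 2 ^ n))"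
        using piece by (intro order_trans[OF sum_abs] sum_mono) auto
      finally show ?thesis
        by simp
    qed
    then show ?thesis
      by blast
  qed
  show ?thesis
    by (rule represented_functional[OF complete]) (rule approx)
qed

lemma Lp_fun_functional_integrable:
  fixes f :: "'a::locally_convex_space \<Rightarrow> real"
  assumes "\<gamma> \<in> Lp_fun p" "1 \<le> p" "linear f" "continuous_on UNIV f"
  shows "integrable (lebesgue_on {0..1}) (\<lambda>t. f (\<gamma> t))"
proof (rule Bochner_Integration.integrable_bound)
  show "integrable (lebesgue_on {0..1}) (\<lambda>t. \<bar>f (\<gamma> t)\<bar>)"
    by (rule Lp_fun_imp_L1[OF assms(1,2) continuous_seminorm_abs_linear[OF assms(3,4)]])
  have "lusin_measurable \<gamma>"
    using assms(1) by (simp add: Lp_fun_iff)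
  from lusin_measurable_compose[OF this assms(4)]
  show "(\<lambda>t. f (\<gamma> t)) \<in> borel_measurable (lebesgue_on {0..1})"
    by (rule lusin_measurable_imp_borel_measurable)
qed auto

text \<open>The integral over \<open>K n \<inter> S\<close> is represented by a point
  \<open>X n\<close>. For every \<open>f\<close> in the polar of \<open>q\<close> the remaining part
  of the integral is at most the integral of \<open>q (\<gamma> t)\<close> over the part of
  \<open>S\<close> outside \<open>K n\<close>, a quantity that does not involve \<open>f\<close> and
  tends to 0.\<close>

theorem has_pettis_integral_exists:
  fixes \<gamma> :: "real \<Rightarrow> 'a::locally_convex_space"
  assumes complete: "sequentially_complete TYPE('a)" and \<gamma>: "\<gamma> \<in> Lp_fun p" "1 \<le> p"
    and S: "compact S" "S \<subseteq> {0..1}"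
  obtains z where "has_pettis_integral \<gamma> z S"
proof -
  have lusin: "lusin_measurable \<gamma>"
    using \<gamma>(1) by (simp add: Lp_fun_iff)
  obtain K :: "nat \<Rightarrow> real set" where K: "\<And>n. compact (K n)" "\<And>n. K n \<subseteq> {0..1}" "incseq K"
    "\<And>n. continuous_on (K n) \<gamma>" "negligible ({0..1} - (\<Union>n. K n))"
    using lusin_measurable_exhaustion[OF lusin] by metis
  have S_sets: "S \<in> sets lebesgue"
    by (rule compact_sets_lebesgue[OF S(1)])
  have int_f: "integrable (lebesgue_on S) (\<lambda>t. f (\<gamma> t))" if "linear f" "continuous_on UNIV f" for f :: "'a \<Rightarrow> real"
    by (rule integrable_lebesgue_on_subset[OF Lp_fun_functional_integrable[OF \<gamma> that] S(2) S_sets]) simp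
  have "\<exists>z. \<forall>f :: 'a \<Rightarrow> real. linear f \<and> continuous_on UNIV f \<longrightarrow> f z = (LINT t|lebesgue_on (K n \<inter> S). f (\<gamma> t))" for n
  proof -
    have "K n \<inter> S \<subseteq> {0..1}" "continuous_on (K n \<inter> S) \<gamma>"
      using S(2) continuous_on_subset[OF K(4) Int_lower1, of n S] by auto
    from integral_functional_on_compact[OF complete compact_Int[OF K(1) S(1)] this] show ?thesis .
  qed
  from choice[OF allI[OF this]] obtain X where "\<forall>n. \<forall>f :: 'a \<Rightarrow> real. linear f \<and> continuous_on UNIV f \<longrightarrow>
      f (X n) = (LINT t|lebesgue_on (K n \<inter> S). f (\<gamma> t))" ..
  note X = this[rule_format, OF conjI]
  have K_sets: "K n \<in> sets lebesgue" for n
    by (rule compact_sets_lebesgue[OF K(1)])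
  have approx: "\<exists>N. \<forall>n\<ge>N. \<forall>f. linear f \<and> (\<forall>x. \<bar>f x\<bar> \<le> q x) \<longrightarrow>
      \<bar>f (X n) - (LINT t|lebesgue_on S. f (\<gamma> t))\<bar> \<le> e"
    if q: "continuous_seminorm q" and "0 < e" for q :: "'a \<Rightarrow> real" and e
  proof -
    have int_q: "integrable (lebesgue_on S) (\<lambda>t. q (\<gamma> t))"
      by (rule integrable_lebesgue_on_subset[OF Lp_fun_imp_L1[OF \<gamma> q] S(2) S_sets]) simp
    have Km: "K n \<inter> S \<in> sets (lebesgue_on S)" for n
      using K_sets[of n] S_sets by (simp add: sets_restrict_space_iff)
    have tail_meas: "(\<lambda>t. if t \<in> K n then g t else h t) \<in> borel_measurable (lebesgue_on S)"
      if "g \<in> borel_measurable (lebesgue_on S)" "h \<in> borel_measurable (lebesgue_on S)"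
      for g h :: "real \<Rightarrow> real" and n
      using that Km[of n] by (intro measurable_If) (auto simp: space_restrict_space Int_def conj_commute)
    have "(\<lambda>n. LINT t|lebesgue_on S. (if t \<in> K n then 0 else q (\<gamma> t))) \<longlonglongrightarrow> (LINT t|lebesgue_on S. 0)"
    proof (rule integral_dominated_convergence[OF _ _ int_q])
      show "(\<lambda>t. if t \<in> K n then 0 else q (\<gamma> t)) \<in> borel_measurable (lebesgue_on S)" for n
        using int_q by (intro tail_meas) auto
      have "AE t in lebesgue. t \<notin> {0..1} - (\<Union>n. K n)"
        using K(5) by (intro AE_not_in) (simp add: negligible_iff_null_sets)
      then have "AE t in lebesgue_on S. t \<in> (\<Union>n. K n)"
        using S(2) S_sets by (auto simp: AE_restrict_space_iff subset_iff elim!: eventually_mono)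
      then show "AE t in lebesgue_on S. (\<lambda>n. if t \<in> K n then 0 else q (\<gamma> t)) \<longlonglongrightarrow> 0"
      proof eventually_elim
        case (elim t)
        then obtain N where "t \<in> K N"
          by blast
        \<comment> \<open>Since \<open>K\<close> is increasing, a point once covered stays
          covered.\<close>
        then have "\<forall>\<^sub>F n in sequentially. (if t \<in> K n then 0 else q (\<gamma> t)) = 0"
          using K(3) by (auto simp: eventually_sequentially incseq_def)
        then show ?case
          by (rule tendsto_eventually)
      qed
      show "AE t in lebesgue_on S. norm (if t \<in> K n then 0 else q (\<gamma> t)) \<le> q (\<gamma> t)" for n
        using continuous_seminormD(1)[OF q] by auto
    qed simp
    then have "(\<lambda>n. LINT t|lebesgue_on S. (if t \<in> K n then 0 else q (\<gamma> t))) \<longlonglongrightarrow> 0"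
      by simp
    from LIMSEQ_D[OF this \<open>0 < e\<close>]
    obtain N where N: "\<And>n. n \<ge> N \<Longrightarrow> \<bar>LINT t|lebesgue_on S. (if t \<in> K n then 0 else q (\<gamma> t))\<bar> < e"
      by auto
    have "\<bar>f (X n) - (LINT t|lebesgue_on S. f (\<gamma> t))\<bar> \<le> e"
      if "n \<ge> N" and f: "linear f" and f_le: "\<And>x. \<bar>f x\<bar> \<le> q x" for n f
    proof -
      have cont: "continuous_on UNIV f"
        by (rule continuous_on_linear_le_seminorm[OF q f f_le])
      have intf: "integrable (lebesgue_on S) (\<lambda>t. f (\<gamma> t))"
        by (rule int_f[OF f cont])
      have intK: "integrable (lebesgue_on S) (\<lambda>t. if t \<in> K n then f (\<gamma> t) else 0)"
        by (rule Bochner_Integration.integrable_bound[OF intf tail_meas]) (use intf in auto)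
      have intKq: "integrable (lebesgue_on S) (\<lambda>t. if t \<in> K n then 0 else q (\<gamma> t))"
        by (rule Bochner_Integration.integrable_bound[OF int_q tail_meas]) (use int_q in auto)
      have "f (X n) = (LINT t|lebesgue_on S. (if t \<in> K n then f (\<gamma> t) else 0))"
        using X[OF f cont, of n] K_sets S_sets by (simp add: Lebesgue_Measure.integral_restrict_Int)
      then have "f (X n) - (LINT t|lebesgue_on S. f (\<gamma> t)) =
          (LINT t|lebesgue_on S. (if t \<in> K n then f (\<gamma> t) else 0) - f (\<gamma> t))"
        using intf intK by simp
      also have "\<bar>\<dots>\<bar> \<le> (LINT t|lebesgue_on S. \<bar>(if t \<in> K n then f (\<gamma> t) else 0) - f (\<gamma> t)\<bar>)"
        by (rule integral_abs_bound)
      also have "\<dots> \<le> (LINT t|lebesgue_on S. (if t \<in> K n then 0 else q (\<gamma> t)))"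
        using intf intK intKq f_le by (intro integral_mono) auto
      also have "\<dots> \<le> e"
        using N[OF \<open>n \<ge> N\<close>] by simp
      finally show ?thesis .
    qed
    then show ?thesis
      by blast
  qed
  have "\<exists>z. \<forall>f :: 'a \<Rightarrow> real. linear f \<and> continuous_on UNIV f \<longrightarrow> f z = (LINT t|lebesgue_on S. f (\<gamma> t))"
    by (rule represented_functional[OF complete]) (rule approx)
  then obtain z where
    "\<forall>f :: 'a \<Rightarrow> real. linear f \<and> continuous_on UNIV f \<longrightarrow> f z = (LINT t|lebesgue_on S. f (\<gamma> t))" ..
  note z = this[rule_format]
  have "has_pettis_integral \<gamma> z S"
    unfolding has_pettis_integral_def
  proof (intro allI impI)
    fix f :: "'a \<Rightarrow> real" assume f: "linear f \<and> continuous_on UNIV f"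
    then have "integrable (lebesgue_on S) (\<lambda>t. f (\<gamma> t))"
      by (intro int_f) auto
    with z[OF f] show "integrable (lebesgue_on S) (\<lambda>t. f (\<gamma> t)) \<and> f z = (LINT t|lebesgue_on S. f (\<gamma> t))"
      by (intro conjI)
  qed
  then show thesis
    by (rule that)
qed

text \<open>This is what gives the definite description in \<open>pettis_integral\<close> its
  value.\<close>

lemma has_pettis_integral_unique:
  fixes z :: "'a::{locally_convex_space,t2_space}"
  assumes "has_pettis_integral \<gamma> z S" "has_pettis_integral \<gamma> w S"
  shows "z = w"
proof (rule continuous_functionals_separate)
  fix f :: "'a \<Rightarrow> real" assume "linear f" "continuous_on UNIV f"
  then have "f z = (LINT t|lebesgue_on S. f (\<gamma> t))" "f w = (LINT t|lebesgue_on S. f (\<gamma> t))"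
    using assms unfolding has_pettis_integral_def by blast+
  then show "f z = f w"
    by simp
qed

lemma has_pettis_integral_pettis_integral:
  fixes \<gamma> :: "real \<Rightarrow> 'a::{locally_convex_space,t2_space}"
  assumes "sequentially_complete TYPE('a)" "\<gamma> \<in> Lp_fun p" "1 \<le> p" "compact S" "S \<subseteq> {0..1}"
  shows "has_pettis_integral \<gamma> (pettis_integral S \<gamma>) S"
proof -
  obtain z where "has_pettis_integral \<gamma> z S"
    using has_pettis_integral_exists[OF assms] by blast
  then show ?thesis
    unfolding pettis_integral_def by (rule theI) (rule has_pettis_integral_unique[OF _ \<open>has_pettis_integral \<gamma> z S\<close>])
qed

subsection \<open>Convergence of dyadic averages\<close>

lemma dyadic_interval_integrable:
  fixes h :: "real \<Rightarrow> real"
  assumes "integrable (lebesgue_on {0..1}) h" "j \<in> {1..2 ^ n}"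
  shows "integrable (lebesgue_on (dyadic_interval n j)) h"
  by (rule integrable_lebesgue_on_subset[OF assms(1) dyadic_interval_subset[OF assms(2)]]) simp_all

lemma Lp_fun_diff_const:
  fixes \<gamma> :: "real \<Rightarrow> 'a::locally_convex_space"
  assumes "\<gamma> \<in> Lp_fun p" "0 \<le> p"
  shows "(\<lambda>t. \<gamma> t - x) \<in> Lp_fun p"
proof (rule Lp_fun_diff[OF assms(1) _ assms(2)])
  show "(\<lambda>t. x) \<in> Lp_fun p"
    by (simp add: Lp_fun_iff lusin_measurable_const integrable_const_ivl)
qed

text \<open>Dominated convergence along the thresholds \<open>real (Suc n)\<close>; the successor
  guarantees \<open>1 \<le> m\<close>, so that one may later divide by
  \<open>(2 * m) powr p\<close>.\<close>

lemma truncation_Lp: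
  fixes g :: "real \<Rightarrow> real"
  assumes "integrable M (\<lambda>t. g t powr p)" "g \<in> borel_measurable M" "0 < e"
  obtains m :: real where "1 \<le> m" "integrable M (\<lambda>t. if g t > m then g t powr p else 0)"
    "(LINT t|M. (if g t > m then g t powr p else 0)) \<le> e"
proof -
  have meas: "(\<lambda>t. if g t > m then g t powr p else 0) \<in> borel_measurable M" for m
    using assms(2) by measurable
  have "(\<lambda>n. LINT t|M. (if g t > real (Suc n) then g t powr p else 0)) \<longlonglongrightarrow> (LINT t|M. 0)"
  proof (rule integral_dominated_convergence[OF _ meas assms(1)])
    show "AE t in M. (\<lambda>n. if g t > real (Suc n) then g t powr p else 0) \<longlonglongrightarrow> 0"
    proof (rule AE_I2)
      fix t
      obtain N :: nat where N: "g t \<le> real N"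
        using real_arch_simple by blast
      have "\<forall>\<^sub>F n in sequentially. (if g t > real (Suc n) then g t powr p else 0) = 0"
        using N by (intro eventually_sequentiallyI[of N]) auto
      then show "(\<lambda>n. if g t > real (Suc n) then g t powr p else 0) \<longlonglongrightarrow> 0"
        by (rule tendsto_eventually)
    qed
  qed auto
  then have "(\<lambda>n. LINT t|M. (if g t > real (Suc n) then g t powr p else 0)) \<longlonglongrightarrow> 0"
    by simp
  from LIMSEQ_D[OF this assms(3)]
  obtain n where "\<bar>LINT t|M. (if g t > real (Suc n) then g t powr p else 0)\<bar> < e"
    by auto
  then show thesis
    using Bochner_Integration.integrable_bound[OF assms(1) meas[of "real (Suc n)"]]
    by (intro that[of "real (Suc n)"]) auto
qed

text \<open>The values \<open>x j\<close> are values of \<open>\<gamma>\<close> at points of \<open>K\<close> where \<open>q (\<gamma> t)\<close> is at most \<open>m\<close>: the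
  threshold \<open>m\<close> is fixed first, and \<open>K\<close> is chosen afterwards so that \<open>m\<close> times the measure of its
  complement is small.\<close>
lemma dyadic_step_approximation:
  fixes \<gamma> :: "real \<Rightarrow> 'a::locally_convex_space"
  assumes \<gamma>: "\<gamma> \<in> Lp_fun p" and p: "1 \<le> p" and q: "continuous_seminorm q" and "0 < e"
  obtains N where "\<And>n. n \<ge> N \<Longrightarrow>
    \<exists>x. (\<Sum>j = 1..2 ^ n. LINT t|lebesgue_on (dyadic_interval n j). q (\<gamma> t - x j) powr p) \<le> e"
proof -
  have lusin: "lusin_measurable \<gamma>" and int: "integrable (lebesgue_on {0..1}) (\<lambda>t. q (\<gamma> t) powr p)"
    using \<gamma> q by (auto simp: Lp_fun_iff)
  have nonneg: "0 \<le> q x" for x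
    by (rule continuous_seminormD(1)[OF q])
  \<comment> \<open>The error \<open>e\<close> is shared equally among large values of
    \<open>q (\<gamma> t)\<close>, the complement of \<open>K\<close>, and the oscillation on
    \<open>K\<close>. The divisors \<open>2 powr p\<close> and \<open>(2 * m) powr p\<close>
    anticipate the coefficients in \<open>h\<close>.\<close>
  have "0 < e / 3 / 2 powr p"
    using \<open>0 < e\<close> by simp
  then obtain m :: real where m: "1 \<le> m"
      "integrable (lebesgue_on {0..1}) (\<lambda>t. if q (\<gamma> t) > m then q (\<gamma> t) powr p else 0)"
      "(LINT t|lebesgue_on {0..1}. (if q (\<gamma> t) > m then q (\<gamma> t) powr p else 0)) \<le> e / 3 / 2 powr p"
    by (rule truncation_Lp[OF int lusin_measurable_seminorm[OF lusin q]])
  have "0 < e / 3 / (2 * m) powr p"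
    using \<open>0 < e\<close> m(1) by simp
  then obtain K where K: "compact K" "K \<subseteq> {0..1}" "continuous_on K \<gamma>"
      "measure lebesgue ({0..1} - K) \<le> e / 3 / (2 * m) powr p"
    using lusin unfolding lusin_measurable_def by blast
  define e0 where "e0 = (e / 3) powr (1 / p)"
  have "0 < e0"
    using \<open>0 < e\<close> by (simp add: e0_def)
  then obtain d where d: "0 < d" "\<And>s t. s \<in> K \<Longrightarrow> t \<in> K \<Longrightarrow> dist s t < d \<Longrightarrow> q (\<gamma> s - \<gamma> t) < e0"
    using seminorm_uniformly_continuous_on_compact[OF K(1,3) q] by blast
  obtain N where N: "(1 / 2) ^ N < d"
    using real_arch_pow_inv[OF d(1), of "1 / 2"] by auto
  \<comment> \<open>A majorant that does not depend on \<open>n\<close>, with one summand for each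
    kind of point: \<open>q (\<gamma> t - x j)\<close> is below \<open>e0\<close> on
    \<open>K\<close> where \<open>q (\<gamma> t) \<le> m\<close>, at most \<open>2 * m\<close> off
    \<open>K\<close> under the same bound, and at most \<open>2 * q (\<gamma> t)\<close> where
    \<open>q (\<gamma> t) > m\<close>.\<close>
  define h where "h t = e0 powr p + (2 * m) powr p * indicat_real ({0..1} - K) t +
    2 powr p * (if q (\<gamma> t) > m then q (\<gamma> t) powr p else 0)" for t
  have IK: "{0..1} - K \<in> sets lebesgue"
    by (rule sets.Diff[OF _ compact_sets_lebesgue[OF K(1)]]) simp
  then have IK': "{0..1} - K \<in> sets (lebesgue_on {0..1})"
    by (simp add: sets_restrict_space_iff)
  interpret finite_measure "lebesgue_on {0..1::real}"
    by (rule finite_measure_lebesgue_on) simp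
  have int_ind: "integrable (lebesgue_on {0..1}) (indicat_real ({0..1} - K))"
    using IK' by (intro integrable_real_indicator) (auto simp: emeasure_eq_measure)
  then have int_h: "integrable (lebesgue_on {0..1}) h"
    unfolding h_def using m(2) by (intro Bochner_Integration.integrable_add integrable_mult_right) auto
  have "(LINT t|lebesgue_on {0..1}. h t) = e0 powr p + (2 * m) powr p * measure lebesgue ({0..1} - K) +
      2 powr p * (LINT t|lebesgue_on {0..1}. (if q (\<gamma> t) > m then q (\<gamma> t) powr p else 0))"
    unfolding h_def using m(2) int_ind IK IK'
    by (simp add: measure_restrict_space space_restrict_space Int_absorb2)
  also have "\<dots> \<le> e / 3 + e / 3 + e / 3"
  proof (intro add_mono)
    show "e0 powr p \<le> e / 3"
      using p \<open>0 < e\<close> by (simp add: e0_def powr_powr)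
    show "(2 * m) powr p * measure lebesgue ({0..1} - K) \<le> e / 3"
      using mult_left_mono[OF K(4), of "(2 * m) powr p"] m(1) by simp
    show "2 powr p * (LINT t|lebesgue_on {0..1}. (if q (\<gamma> t) > m then q (\<gamma> t) powr p else 0)) \<le> e / 3"
      using mult_left_mono[OF m(3), of "2 powr p"] by simp
  qed
  finally have h_le: "(LINT t|lebesgue_on {0..1}. h t) \<le> e"
    by simp
  show thesis
  proof (rule that[of N])
    fix n assume "n \<ge> N"
    \<comment> \<open>The default 0 also satisfies \<open>q (x j) \<le> m\<close>, so the two cases
      in which no nearby value of \<open>\<gamma>\<close> is used need no distinction.\<close>
    define x where "x j = (if \<exists>t. t \<in> K \<inter> dyadic_interval n j \<and> q (\<gamma> t) \<le> m
      then \<gamma> (SOME t. t \<in> K \<inter> dyadic_interval n j \<and> q (\<gamma> t) \<le> m) else 0)" for j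
    have x: "\<exists>s\<in>K \<inter> dyadic_interval n j. x j = \<gamma> s \<and> q (\<gamma> s) \<le> m"
      if "t \<in> K \<inter> dyadic_interval n j" "q (\<gamma> t) \<le> m" for j t
    proof -
      define s where "s = (SOME t. t \<in> K \<inter> dyadic_interval n j \<and> q (\<gamma> t) \<le> m)"
      have ex: "\<exists>t. t \<in> K \<inter> dyadic_interval n j \<and> q (\<gamma> t) \<le> m"
        using that by blast
      then have "x j = \<gamma> s" "s \<in> K \<inter> dyadic_interval n j \<and> q (\<gamma> s) \<le> m"
        using someI_ex[OF ex] unfolding x_def s_def by (simp_all only: if_True)
      then show ?thesis
        by blast
    qed
    have x_le: "q (x j) \<le> m" for j
    proof (cases "\<exists>t. t \<in> K \<inter> dyadic_interval n j \<and> q (\<gamma> t) \<le> m")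
      case True
      then show ?thesis
        using x by force
    next
      case False
      then have "x j = 0"
        by (simp only: x_def if_False)
      then show ?thesis
        using m(1) by (simp add: continuous_seminormD(5)[OF q])
    qed
    have le_h: "q (\<gamma> t - x j) powr p \<le> h t" if j: "j \<in> {1..2 ^ n}" and t: "t \<in> dyadic_interval n j" for t j
    proof -
      have t01: "t \<in> {0..1}"
        using dyadic_interval_subset[OF j] t by blast
      have tri: "q (\<gamma> t - x j) \<le> q (\<gamma> t) + m"
        using continuous_seminorm_diff_le[OF q, of "\<gamma> t" "x j"] x_le[of j] by linarith
      consider "q (\<gamma> t) > m" | "q (\<gamma> t) \<le> m" "t \<notin> K" | "q (\<gamma> t) \<le> m" "t \<in> K"
        by linarith
      then show ?thesis
      proof cases
        case 1
        have "q (\<gamma> t - x j) powr p \<le> (2 * q (\<gamma> t)) powr p"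
          using 1 tri p by (intro powr_mono2 nonneg) auto
        also have "\<dots> = 2 powr p * q (\<gamma> t) powr p"
          by (simp add: powr_mult nonneg)
        also have "\<dots> \<le> h t"
          using 1 by (simp add: h_def)
        finally show ?thesis .
      next
        case 2
        have "q (\<gamma> t - x j) powr p \<le> (2 * m) powr p"
          using 2 tri p by (intro powr_mono2 nonneg) auto
        also have "\<dots> \<le> h t"
          using 2 t01 by (simp add: h_def)
        finally show ?thesis .
      next
        case 3
        then obtain s where s: "s \<in> K \<inter> dyadic_interval n j" "x j = \<gamma> s"
          using x[of t j] t by blast
        have "\<bar>t - s\<bar> \<le> real j / 2 ^ n - (real j - 1) / 2 ^ n"
          using s t by (auto simp: dyadic_interval_def)
        also have "\<dots> = (1 / 2) ^ n"
          by (simp add: diff_divide_distrib power_one_over)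
        also have "\<dots> \<le> (1 / 2) ^ N"
          using \<open>n \<ge> N\<close> by (intro power_decreasing) auto
        finally have "q (\<gamma> t - x j) < e0"
          using N s 3 by (auto simp: dist_real_def intro!: d(2))
        then have "q (\<gamma> t - x j) powr p \<le> e0 powr p"
          using p by (intro powr_mono2 nonneg) auto
        also have "\<dots> \<le> h t"
          by (simp add: h_def)
        finally show ?thesis .
      qed
    qed
    have "(\<Sum>j = 1..2 ^ n. LINT t|lebesgue_on (dyadic_interval n j). q (\<gamma> t - x j) powr p) \<le>
        (\<Sum>j = 1..2 ^ n. LINT t|lebesgue_on (dyadic_interval n j). h t)"
    proof (rule sum_mono, rule integral_mono)
      fix j :: nat assume j: "j \<in> {1..2 ^ n}"
      show "integrable (lebesgue_on (dyadic_interval n j)) h"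
        by (rule dyadic_interval_integrable[OF int_h j])
      have "integrable (lebesgue_on {0..1}) (\<lambda>t. q (\<gamma> t - x j) powr p)"
        using Lp_fun_diff_const[OF \<gamma>, of "x j"] p q by (simp add: Lp_fun_iff)
      then show "integrable (lebesgue_on (dyadic_interval n j)) (\<lambda>t. q (\<gamma> t - x j) powr p)"
        by (rule dyadic_interval_integrable[OF _ j])
      show "q (\<gamma> t - x j) powr p \<le> h t" if "t \<in> space (lebesgue_on (dyadic_interval n j))" for t
        using le_h[OF j] that by (simp add: space_restrict_space)
    qed
    also have "\<dots> \<le> e"
      unfolding sum_dyadic_interval_integral[OF int_h] by (rule h_le)
    finally show "\<exists>x. (\<Sum>j = 1..2 ^ n. LINT t|lebesgue_on (dyadic_interval n j). q (\<gamma> t - x j) powr p) \<le> e"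
      by (rule exI[of _ x])
  qed
qed

text \<open>A functional that norms the average minus \<open>x\<close> brings \<open>q\<close> under
  the integral, and Jensen's inequality then brings in the power. Since the average of the constant
  \<open>x\<close> is \<open>x\<close>, this one estimate contains both the contraction property and
  the invariance of step functions.\<close>

lemma seminorm_pettis_average_le:
  fixes \<gamma> :: "real \<Rightarrow> 'a::locally_convex_space"
  assumes \<gamma>: "\<gamma> \<in> Lp_fun p" "1 \<le> p" and q: "continuous_seminorm q"
    and S: "S \<in> lmeasurable" "S \<subseteq> {0..1}" "0 < measure lebesgue S"
    and z: "has_pettis_integral \<gamma> z S"
  shows "measure lebesgue S * q ((1 / measure lebesgue S) *\<^sub>R z - x) powr p \<le>
    (LINT t|lebesgue_on S. q (\<gamma> t - x) powr p)"
proof -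
  define m where "m = measure lebesgue S"
  have "0 < m"
    using S(3) by (simp add: m_def)
  have S_sets: "S \<in> sets lebesgue"
    by (rule fmeasurableD[OF S(1)])
  interpret finite_measure "lebesgue_on S"
    by (rule finite_measure_lebesgue_on[OF S(1)])
  have meas: "measure (lebesgue_on S) (space (lebesgue_on S)) = m"
    using S_sets by (simp add: m_def measure_restrict_space space_restrict_space)
  have diff: "(\<lambda>t. \<gamma> t - x) \<in> Lp_fun p"
    by (rule Lp_fun_diff_const[OF \<gamma>(1)]) (use \<gamma>(2) in simp)
  have int_p: "integrable (lebesgue_on S) (\<lambda>t. q (\<gamma> t - x) powr p)"
    by (rule integrable_lebesgue_on_subset[OF _ S(2) S_sets]) (use diff q in \<open>simp_all add: Lp_fun_iff\<close>)
  have int_1: "integrable (lebesgue_on S) (\<lambda>t. q (\<gamma> t - x))"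
    by (rule integrable_lebesgue_on_subset[OF Lp_fun_imp_L1[OF diff \<gamma>(2) q] S(2) S_sets]) simp
  obtain f where f: "linear f" "\<And>x. \<bar>f x\<bar> \<le> q x" "f ((1 / m) *\<^sub>R z - x) = q ((1 / m) *\<^sub>R z - x)"
    using Hahn_Banach_seminorm[OF q] by blast
  have "continuous_on UNIV f"
    by (rule continuous_on_linear_le_seminorm[OF q f(1,2)])
  then have fz: "integrable (lebesgue_on S) (\<lambda>t. f (\<gamma> t))" "f z = (LINT t|lebesgue_on S. f (\<gamma> t))"
    using z f(1) unfolding has_pettis_integral_def by blast+
  have "m * f ((1 / m) *\<^sub>R z - x) = f z - m * f x"
    using \<open>0 < m\<close> by (simp add: linear_diff[OF f(1)] linear_scale[OF f(1)] field_simps)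
  also have "\<dots> = (LINT t|lebesgue_on S. f (\<gamma> t) - f x)"
    using fz meas by simp
  also have "\<dots> \<le> (LINT t|lebesgue_on S. q (\<gamma> t - x))"
  proof (rule integral_mono)
    show "f (\<gamma> t) - f x \<le> q (\<gamma> t - x)" for t
      using f(2)[of "\<gamma> t - x"] by (simp add: linear_diff[OF f(1)])
  qed (use fz int_1 in auto)
  finally have "q ((1 / m) *\<^sub>R z - x) \<le> (LINT t|lebesgue_on S. q (\<gamma> t - x)) / m"
    using \<open>0 < m\<close> f(3) by (simp add: field_simps)
  then have "q ((1 / m) *\<^sub>R z - x) powr p \<le> ((LINT t|lebesgue_on S. q (\<gamma> t - x)) / m) powr p"
    using \<gamma>(2) continuous_seminormD(1)[OF q] by (intro powr_mono2) auto
  also have "\<dots> \<le> (LINT t|lebesgue_on S. q (\<gamma> t - x) powr p) / m"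
    by (rule Jensen_powr[OF int_1 int_p continuous_seminormD(1)[OF q] \<gamma>(2), unfolded meas, OF \<open>0 < m\<close>])
  finally show ?thesis
    using \<open>0 < m\<close> by (simp add: m_def field_simps)
qed

text \<open>The intervals are closed, so at a partition point inside the unit interval two summands
  are added; the formula is therefore claimed for interior points only.\<close>

lemma dyadic_average_interior:
  assumes j: "j \<in> {1..2 ^ n}" and t: "(real j - 1) / 2 ^ n < t" "t < real j / 2 ^ n"
  shows "dyadic_average \<gamma> n t = 2 ^ n *\<^sub>R pettis_integral (dyadic_interval n j) \<gamma>"
proof -
  have "indicat_real (dyadic_interval n i) t = 0" if "i \<noteq> j" for i
  proof (rule ccontr)
    assume "indicat_real (dyadic_interval n i) t \<noteq> 0"
    then have "(real i - 1) / 2 ^ n \<le> t" "t \<le> real i / 2 ^ n"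
      by (auto simp: dyadic_interval_def indicator_def split: if_splits)
    with t have "(real i - 1) / 2 ^ n < real j / 2 ^ n" "(real j - 1) / 2 ^ n < real i / 2 ^ n"
      by linarith+
    then have "real i - 1 < real j" "real j - 1 < real i"
      by (simp_all add: divide_less_cancel)
    with \<open>i \<noteq> j\<close> show False
      by linarith
  qed
  then have "dyadic_average \<gamma> n t = (\<Sum>i = 1..2 ^ n. if i = j then
      indicat_real (dyadic_interval n j) t *\<^sub>R (2 ^ n *\<^sub>R pettis_integral (dyadic_interval n j) \<gamma>) else 0)"
    unfolding dyadic_average_def by (intro sum.cong) auto
  also have "\<dots> = indicat_real (dyadic_interval n j) t *\<^sub>R (2 ^ n *\<^sub>R pettis_integral (dyadic_interval n j) \<gamma>)"
    using j by simp
  also have "indicat_real (dyadic_interval n j) t = 1"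
    using t by (simp add: dyadic_interval_def)
  finally show ?thesis
    by simp
qed

lemma seminorm_sum_le:
  assumes q: "continuous_seminorm q"
  shows "q (\<Sum>i\<in>I. x i) \<le> (\<Sum>i\<in>I. q (x i))"
proof (induction I rule: infinite_finite_induct)
  case (insert i I)
  then show ?case
    using continuous_seminormD(2)[OF q, of "x i" "\<Sum>i\<in>I. x i"] by simp
qed (simp_all add: continuous_seminormD(5)[OF q])

lemma dyadic_average_in_Lp_fun:
  fixes \<gamma> :: "real \<Rightarrow> 'a::locally_convex_space"
  assumes "0 \<le> p"
  shows "dyadic_average \<gamma> n \<in> Lp_fun p"
  unfolding Lp_fun_iff
proof (intro conjI allI impI)
  show lusin: "lusin_measurable (dyadic_average \<gamma> n)"
    unfolding dyadic_average_def
    by (intro lusin_measurable_sum lusin_measurable_scaleR lusin_measurable_const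
        lusin_measurable_indicator dyadic_interval_sets)
  fix q :: "'a \<Rightarrow> real" assume q: "continuous_seminorm q"
  interpret finite_measure "lebesgue_on {0..1::real}"
    by (rule finite_measure_lebesgue_on) simp
  \<comment> \<open>The sum over all \<open>j\<close>, unlike the maximum, also bounds the value at
    points that lie in two intervals.\<close>
  define B where "B = (\<Sum>j = 1..2 ^ n. q (2 ^ n *\<^sub>R pettis_integral (dyadic_interval n j) \<gamma>))"
  have "q (dyadic_average \<gamma> n t) \<le> B" for t
    unfolding dyadic_average_def B_def
  proof (intro order_trans[OF seminorm_sum_le[OF q]] sum_mono)
    fix j :: nat
    show "q (indicat_real (dyadic_interval n j) t *\<^sub>R 2 ^ n *\<^sub>R pettis_integral (dyadic_interval n j) \<gamma>) \<le>
        q (2 ^ n *\<^sub>R pettis_integral (dyadic_interval n j) \<gamma>)"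
      using continuous_seminormD(1)[OF q]
      by (cases "t \<in> dyadic_interval n j") (simp_all add: continuous_seminormD(5)[OF q])
  qed
  then have "norm (q (dyadic_average \<gamma> n t) powr p) \<le> B powr p" for t
    using continuous_seminormD(1)[OF q] assms by (simp add: powr_mono2)
  moreover have "(\<lambda>t. q (dyadic_average \<gamma> n t) powr p) \<in> borel_measurable (lebesgue_on {0..1})"
    using lusin_measurable_seminorm[OF lusin q] by measurable
  ultimately show "integrable (lebesgue_on {0..1}) (\<lambda>t. q (dyadic_average \<gamma> n t) powr p)"
    by (intro integrable_const_bound[of _ "B powr p"] AE_I2)
qed

lemma AE_dyadic_average:
  fixes \<gamma> :: "real \<Rightarrow> 'a::locally_convex_space"
  assumes "j \<in> {1..2 ^ n}"
  shows "AE t in lebesgue_on (dyadic_interval n j).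
    dyadic_average \<gamma> n t = 2 ^ n *\<^sub>R pettis_integral (dyadic_interval n j) \<gamma>"
proof -
  have "{(real j - 1) / 2 ^ n, real j / 2 ^ n} \<in> null_sets lebesgue"
    by (simp add: negligible_finite flip: negligible_iff_null_sets)
  then have "AE t in lebesgue. t \<notin> {(real j - 1) / 2 ^ n, real j / 2 ^ n}"
    by (rule AE_not_in)
  then have "AE t in lebesgue. t \<in> dyadic_interval n j \<longrightarrow>
      dyadic_average \<gamma> n t = 2 ^ n *\<^sub>R pettis_integral (dyadic_interval n j) \<gamma>"
    by eventually_elim (intro impI dyadic_average_interior[OF assms], auto simp: dyadic_interval_def)
  then show ?thesis
    by (simp add: AE_restrict_space_iff)
qed

text \<open>The family \<open>x\<close> is arbitrary: it is a step function against which both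
  \<open>\<gamma>\<close> and its average are compared. The factor \<open>2 powr p\<close> comes
  from splitting the power of a sum, the factor 2 from bounding both distances by the same
  integral.\<close>

lemma dyadic_average_Lp_bound:
  fixes \<gamma> :: "real \<Rightarrow> 'a::{locally_convex_space,t2_space}"
  assumes complete: "sequentially_complete TYPE('a)" and \<gamma>: "\<gamma> \<in> Lp_fun p" and p: "1 \<le> p"
    and q: "continuous_seminorm q"
  shows "(LINT t|lebesgue_on {0..1}. q (dyadic_average \<gamma> n t - \<gamma> t) powr p) \<le>
    2 * 2 powr p * (\<Sum>j = 1..2 ^ n. LINT t|lebesgue_on (dyadic_interval n j). q (\<gamma> t - x j) powr p)"
proof -
  have nonneg: "0 \<le> q x" for x
    by (rule continuous_seminormD(1)[OF q])
  have "0 \<le> p"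
    using p by simp
  have int: "integrable (lebesgue_on {0..1}) (\<lambda>t. q (dyadic_average \<gamma> n t - \<gamma> t) powr p)"
    using Lp_fun_diff[OF dyadic_average_in_Lp_fun[OF \<open>0 \<le> p\<close>] \<gamma> \<open>0 \<le> p\<close>] q by (simp add: Lp_fun_iff)
  have piece: "(LINT t|lebesgue_on (dyadic_interval n j). q (dyadic_average \<gamma> n t - \<gamma> t) powr p) \<le>
      2 * 2 powr p * (LINT t|lebesgue_on (dyadic_interval n j). q (\<gamma> t - x j) powr p)"
    if j: "j \<in> {1..2 ^ n}" for j
  proof -
    define D where "D = dyadic_interval n j"
    define z where "z = pettis_integral D \<gamma>"
    have D: "D \<in> lmeasurable" "D \<subseteq> {0..1}" "compact D" "measure lebesgue D = 1 / 2 ^ n"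
      using dyadic_interval_subset[OF j] measure_dyadic_interval[of n j]
      by (simp_all add: D_def dyadic_interval_def)
    interpret finite_measure "lebesgue_on D"
      by (rule finite_measure_lebesgue_on[OF D(1)])
    have meas: "measure (lebesgue_on D) (space (lebesgue_on D)) = 1 / 2 ^ n"
      using D(1,4) by (simp add: measure_restrict_space space_restrict_space fmeasurableD)
    have int_x: "integrable (lebesgue_on D) (\<lambda>t. q (\<gamma> t - x j) powr p)"
      unfolding D_def using Lp_fun_diff_const[OF \<gamma> \<open>0 \<le> p\<close>, of "x j"] q
      by (intro dyadic_interval_integrable[OF _ j]) (simp add: Lp_fun_iff)
    have int_D: "integrable (lebesgue_on D) (\<lambda>t. q (dyadic_average \<gamma> n t - \<gamma> t) powr p)"
      unfolding D_def by (rule dyadic_interval_integrable[OF int j])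
    have "has_pettis_integral \<gamma> z D"
      unfolding z_def by (rule has_pettis_integral_pettis_integral[OF complete \<gamma> p D(3,2)])
    from seminorm_pettis_average_le[OF \<gamma> p q D(1,2) _ this, of "x j"]
    have avg: "q (2 ^ n *\<^sub>R z - x j) powr p / 2 ^ n \<le> (LINT t|lebesgue_on D. q (\<gamma> t - x j) powr p)"
      by (simp add: D(4))
    have "AE t in lebesgue_on D. q (dyadic_average \<gamma> n t - \<gamma> t) powr p \<le>
        2 powr p * (q (2 ^ n *\<^sub>R z - x j) powr p + q (\<gamma> t - x j) powr p)"
      using AE_dyadic_average[OF j, of \<gamma>] unfolding D_def[symmetric] z_def[symmetric]
    proof eventually_elim
      case (elim t)
      have "q (2 ^ n *\<^sub>R z - \<gamma> t) \<le> q (2 ^ n *\<^sub>R z - x j) + q (\<gamma> t - x j)"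
        using continuous_seminorm_diff_le[OF q, of "2 ^ n *\<^sub>R z - x j" "\<gamma> t - x j"] by simp
      then have "q (2 ^ n *\<^sub>R z - \<gamma> t) powr p \<le> (q (2 ^ n *\<^sub>R z - x j) + q (\<gamma> t - x j)) powr p"
        by (intro powr_mono2 nonneg \<open>0 \<le> p\<close>)
      also have "\<dots> \<le> 2 powr p * (q (2 ^ n *\<^sub>R z - x j) powr p + q (\<gamma> t - x j) powr p)"
        by (intro add_powr_le nonneg \<open>0 \<le> p\<close>)
      finally show ?case
        by (simp add: elim)
    qed
    then have "(LINT t|lebesgue_on D. q (dyadic_average \<gamma> n t - \<gamma> t) powr p) \<le>
        (LINT t|lebesgue_on D. 2 powr p * (q (2 ^ n *\<^sub>R z - x j) powr p + q (\<gamma> t - x j) powr p))"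
      using int_D int_x by (intro integral_mono_AE) auto
    also have "\<dots> = 2 powr p * (q (2 ^ n *\<^sub>R z - x j) powr p / 2 ^ n +
        (LINT t|lebesgue_on D. q (\<gamma> t - x j) powr p))"
      using int_x meas by simp
    also have "\<dots> \<le> 2 powr p * ((LINT t|lebesgue_on D. q (\<gamma> t - x j) powr p) +
        (LINT t|lebesgue_on D. q (\<gamma> t - x j) powr p))"
      using avg by (intro mult_left_mono) auto
    finally show ?thesis
      by (simp add: D_def)
  qed
  show ?thesis
    unfolding sum_dyadic_interval_integral[OF int, of n, symmetric] sum_distrib_left
    by (intro sum_mono piece)
qed

lemma Lp_seminorm_dyadic_average_tendsto:
  fixes \<gamma> :: "real \<Rightarrow> 'a::{locally_convex_space,t2_space}"
  assumes complete: "sequentially_complete TYPE('a)" and \<gamma>: "\<gamma> \<in> Lp_fun p" and p: "1 \<le> p"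
    and q: "continuous_seminorm q"
  shows "(\<lambda>n. Lp_seminorm p q (\<lambda>t. dyadic_average \<gamma> n t - \<gamma> t)) \<longlonglongrightarrow> 0"
proof -
  define I where "I n = (LINT t|lebesgue_on {0..1}. q (dyadic_average \<gamma> n t - \<gamma> t) powr p)" for n
  have I_nonneg: "0 \<le> I n" for n
    by (simp add: I_def)
  have "I \<longlonglongrightarrow> 0"
  proof (rule LIMSEQ_I)
    fix r :: real assume "0 < r"
    \<comment> \<open>Chosen so that \<open>2 * 2 powr p * e = r / 2\<close>.\<close>
    define e where "e = r / (4 * 2 powr p)"
    have "0 < e"
      using \<open>0 < r\<close> by (simp add: e_def)
    then obtain N where N: "\<And>n. n \<ge> N \<Longrightarrow>
        \<exists>x. (\<Sum>j = 1..2 ^ n. LINT t|lebesgue_on (dyadic_interval n j). q (\<gamma> t - x j) powr p) \<le> e"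
      using dyadic_step_approximation[OF \<gamma> p q] by blast
    have "norm (I n - 0) < r" if "n \<ge> N" for n
    proof -
      obtain x where x: "(\<Sum>j = 1..2 ^ n. LINT t|lebesgue_on (dyadic_interval n j). q (\<gamma> t - x j) powr p) \<le> e"
        using N[OF \<open>n \<ge> N\<close>] by blast
      have "I n \<le> 2 * 2 powr p * e"
        unfolding I_def
        by (rule order_trans[OF dyadic_average_Lp_bound[OF complete \<gamma> p q] mult_left_mono[OF x]]) simp
      also have "\<dots> < r"
        using \<open>0 < r\<close> by (simp add: e_def)
      finally show ?thesis
        using I_nonneg[of n] by simp
    qed
    then show "\<exists>N. \<forall>n\<ge>N. norm (I n - 0) < r"
      by blast
  qed
  \<comment> \<open>The base tends to 0, where continuity of the power relies on
    \<open>I n \<ge> 0\<close> and the positive exponent.\<close>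
  then have "(\<lambda>n. I n powr (1 / p)) \<longlonglongrightarrow> 0 powr (1 / p)"
    using p I_nonneg by (intro tendsto_powr') auto
  then show ?thesis
    by (simp add: Lp_seminorm_def I_def)
qed

section \<open>Convergence in the topology of the quotient by almost everywhere equality\<close>

lemma Lp_seminorm_triangle:
  fixes \<gamma> :: "real \<Rightarrow> 'a::locally_convex_space"
  assumes "\<gamma> \<in> Lp_fun p" "\<eta> \<in> Lp_fun p" "\<zeta> \<in> Lp_fun p" and p: "1 \<le> p" and q: "continuous_seminorm q"
  shows "Lp_seminorm p q (\<lambda>t. \<gamma> t - \<zeta> t) \<le>
    Lp_seminorm p q (\<lambda>t. \<gamma> t - \<eta> t) + Lp_seminorm p q (\<lambda>t. \<eta> t - \<zeta> t)"
proof -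
  have "0 \<le> p"
    using p by simp
  have nonneg: "0 \<le> q x" for x
    by (rule continuous_seminormD(1)[OF q])
  have int: "integrable (lebesgue_on {0..1}) (\<lambda>t. q (f t - g t) powr p)"
    and meas: "(\<lambda>t. q (f t - g t)) \<in> borel_measurable (lebesgue_on {0..1})"
    if "f \<in> Lp_fun p" "g \<in> Lp_fun p" for f g
    using Lp_fun_diff[OF that \<open>0 \<le> p\<close>] q lusin_measurable_seminorm[OF _ q, of "\<lambda>t. f t - g t"]
    by (auto simp: Lp_fun_iff)
  have tri: "q (\<gamma> t - \<zeta> t) \<le> q (\<gamma> t - \<eta> t) + q (\<eta> t - \<zeta> t)" for t
    using continuous_seminormD(2)[OF q, of "\<gamma> t - \<eta> t" "\<eta> t - \<zeta> t"] by simp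
  \<comment> \<open>Integrability must be secured first: a non-integrable function has Bochner
    integral 0, and monotonicity could fail.\<close>
  have int_sum: "integrable (lebesgue_on {0..1}) (\<lambda>t. (q (\<gamma> t - \<eta> t) + q (\<eta> t - \<zeta> t)) powr p)"
  proof (rule Bochner_Integration.integrable_bound)
    show "integrable (lebesgue_on {0..1}) (\<lambda>t. 2 powr p * (q (\<gamma> t - \<eta> t) powr p + q (\<eta> t - \<zeta> t) powr p))"
      using int assms(1-3) by simp
    show "(\<lambda>t. (q (\<gamma> t - \<eta> t) + q (\<eta> t - \<zeta> t)) powr p) \<in> borel_measurable (lebesgue_on {0..1})"
      using meas[OF assms(1,2)] meas[OF assms(2,3)] by measurable
    show "AE t in lebesgue_on {0..1}. norm ((q (\<gamma> t - \<eta> t) + q (\<eta> t - \<zeta> t)) powr p) \<le>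
        norm (2 powr p * (q (\<gamma> t - \<eta> t) powr p + q (\<eta> t - \<zeta> t) powr p))"
      using add_powr_le[OF nonneg nonneg \<open>0 \<le> p\<close>] by (intro AE_I2) simp
  qed
  have "(LINT t|lebesgue_on {0..1}. q (\<gamma> t - \<zeta> t) powr p) \<le>
      (LINT t|lebesgue_on {0..1}. (q (\<gamma> t - \<eta> t) + q (\<eta> t - \<zeta> t)) powr p)"
    using int[OF assms(1,3)] int_sum tri nonneg \<open>0 \<le> p\<close> by (intro integral_mono powr_mono2)
  then have "Lp_seminorm p q (\<lambda>t. \<gamma> t - \<zeta> t) \<le>
      (LINT t|lebesgue_on {0..1}. (q (\<gamma> t - \<eta> t) + q (\<eta> t - \<zeta> t)) powr p) powr (1 / p)"
    unfolding Lp_seminorm_def using p by (intro powr_mono2) auto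
  also have "\<dots> \<le> Lp_seminorm p q (\<lambda>t. \<gamma> t - \<eta> t) + Lp_seminorm p q (\<lambda>t. \<eta> t - \<zeta> t)"
    unfolding Lp_seminorm_def using assms(1-3) p
    by (intro Minkowski_powr int meas nonneg)
  finally show ?thesis .
qed

text \<open>A class that lies in the image of a ball has some representative in the ball; this
  transfers the bound to any other representative.\<close>

lemma Lp_seminorm_cong_AE:
  fixes \<gamma> :: "real \<Rightarrow> 'a::locally_convex_space"
  assumes "\<gamma> \<in> Lp_fun p" "\<eta> \<in> Lp_fun p" "\<zeta> \<in> Lp_fun p" "0 \<le> p" and q: "continuous_seminorm q"
    and AE: "AE t in lebesgue_on {0..1}. \<gamma> t = \<eta> t"
  shows "Lp_seminorm p q (\<lambda>t. \<gamma> t - \<zeta> t) = Lp_seminorm p q (\<lambda>t. \<eta> t - \<zeta> t)"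
proof -
  have meas: "(\<lambda>t. q (f t - \<zeta> t) powr p) \<in> borel_measurable (lebesgue_on {0..1})" if "f \<in> Lp_fun p" for f
    using Lp_fun_diff[OF that assms(3,4)] q by (auto simp: Lp_fun_iff)
  have "(LINT t|lebesgue_on {0..1}. q (\<gamma> t - \<zeta> t) powr p) = (LINT t|lebesgue_on {0..1}. q (\<eta> t - \<zeta> t) powr p)"
    using AE by (intro integral_cong_AE meas assms(1,2)) (auto elim: eventually_mono)
  then show ?thesis
    by (simp add: Lp_seminorm_def)
qed

text \<open>It suffices to test convergence on a subbase, since eventual membership survives finite
  intersections and arbitrary unions. The first premise places \<open>l\<close> in the topological
  space.\<close>

lemma limitin_topology_generated_by:
  assumes "l \<in> \<Union>\<S>" and "\<And>U. U \<in> \<S> \<Longrightarrow> l \<in> U \<Longrightarrow> eventually (\<lambda>n. f n \<in> U) F"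
  shows "limitin (topology_generated_by \<S>) f l F"
proof -
  have "generate_topology_on \<S> U \<Longrightarrow> l \<in> U \<Longrightarrow> eventually (\<lambda>n. f n \<in> U) F" for U
  proof (induction U rule: generate_topology_on.induct)
    case (Int a b)
    then show ?case
      by (auto intro: eventually_conj)
  next
    case (UN K)
    then obtain k where "k \<in> K" "l \<in> k" "eventually (\<lambda>n. f n \<in> k) F"
      by blast
    then show ?case
      by (auto elim: eventually_mono)
  qed (use assms(2) in auto)
  then show ?thesis
    using assms(1) by (simp add: limitin_def openin_topology_generated_by_iff)
qed

lemma limitin_Lp_topology:
  fixes \<gamma> :: "real \<Rightarrow> 'a::locally_convex_space"
  assumes p: "1 \<le> p" and \<gamma>: "\<gamma> \<in> Lp_fun p" and \<eta>: "\<And>n. \<eta> n \<in> Lp_fun p"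
    and lim: "\<And>q. continuous_seminorm q \<Longrightarrow> ((\<lambda>n. Lp_seminorm p q (\<lambda>t. \<eta> n t - \<gamma> t)) \<longlongrightarrow> 0) F"
  shows "limitin (Lp_topology p) (\<lambda>n. Lp_class p (\<eta> n)) (Lp_class p \<gamma>) F"
  unfolding Lp_topology_def
proof (rule limitin_topology_generated_by)
  show "Lp_class p \<gamma> \<in> \<Union> {Lp_class p ` {\<eta> \<in> Lp_fun p. Lp_seminorm p q (\<lambda>t. \<eta> t - \<gamma> t) < \<epsilon>} | q \<gamma> \<epsilon>.
      continuous_seminorm q \<and> \<gamma> \<in> Lp_fun p \<and> \<epsilon> > 0}"
    unfolding topology_generated_by_topspace[symmetric] Lp_topology_def[symmetric] topspace_Lp_topology
    unfolding Lp_class_def by (rule quotientI[OF \<gamma>])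
next
  fix U
  assume "U \<in> {Lp_class p ` {\<eta> \<in> Lp_fun p. Lp_seminorm p q (\<lambda>t. \<eta> t - \<gamma> t) < \<epsilon>} | q \<gamma> \<epsilon>.
      continuous_seminorm q \<and> \<gamma> \<in> Lp_fun p \<and> \<epsilon> > 0}" and "Lp_class p \<gamma> \<in> U"
  \<comment> \<open>The ball is centred at an arbitrary \<open>\<zeta>\<close>, and the class of
    \<open>\<gamma>\<close> is known to meet it only through some representative
    \<open>\<xi>\<close>.\<close>
  then obtain q \<zeta> e \<xi> where U: "U = Lp_class p ` {\<eta> \<in> Lp_fun p. Lp_seminorm p q (\<lambda>t. \<eta> t - \<zeta> t) < e}"
    and q: "continuous_seminorm q" and \<zeta>: "\<zeta> \<in> Lp_fun p"
    and \<xi>: "\<xi> \<in> Lp_fun p" "Lp_seminorm p q (\<lambda>t. \<xi> t - \<zeta> t) < e" "Lp_class p \<gamma> = Lp_class p \<xi>"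
    by auto
  have "\<gamma> \<in> Lp_class p \<gamma>"
    using \<gamma> by (simp add: Lp_class_def Lp_rel_def)
  then have "AE t in lebesgue_on {0..1}. \<xi> t = \<gamma> t"
    unfolding \<xi>(3) by (simp add: Lp_class_def Lp_rel_def)
  then have "Lp_seminorm p q (\<lambda>t. \<gamma> t - \<zeta> t) < e"
    using Lp_seminorm_cong_AE[OF \<xi>(1) \<gamma> \<zeta> _ q] \<xi>(2) p by simp
  \<comment> \<open>The slack left by \<open>\<gamma>\<close> is the radius of a ball around
    \<open>\<gamma>\<close> inside the given one, by the triangle inequality.\<close>
  then have "\<forall>\<^sub>F n in F. Lp_seminorm p q (\<lambda>t. \<eta> n t - \<gamma> t) < e - Lp_seminorm p q (\<lambda>t. \<gamma> t - \<zeta> t)"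
    using order_tendstoD(2)[OF lim[OF q]] by simp
  then show "\<forall>\<^sub>F n in F. Lp_class p (\<eta> n) \<in> U"
  proof eventually_elim
    case (elim n)
    then have "Lp_seminorm p q (\<lambda>t. \<eta> n t - \<zeta> t) < e"
      using Lp_seminorm_triangle[OF \<eta> \<gamma> \<zeta> p q, of n] by linarith
    then show ?case
      unfolding U using \<eta> by blast
  qed
qed

text \<open>The first conjunct gives the second its meaning: \<open>Lp_class p\<close> of a function
  outside \<open>Lp_fun p\<close> would be the empty set.\<close>

theorem theorem3p15:
  fixes \<gamma> :: "real \<Rightarrow> 'a::{locally_convex_space,t2_space}" and p :: real
  assumes "sequentially_complete TYPE('a)"
    and "1 \<le> p"
    and "\<gamma> \<in> Lp_fun p"
  shows "(\<forall>n. dyadic_average \<gamma> n \<in> Lp_fun p) \<and>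
    limitin (Lp_topology p) (\<lambda>n. Lp_class p (dyadic_average \<gamma> n)) (Lp_class p \<gamma>) sequentially"
proof
  have in_Lp: "dyadic_average \<gamma> n \<in> Lp_fun p" for n
    by (rule dyadic_average_in_Lp_fun) (use assms(2) in simp)
  then show "\<forall>n. dyadic_average \<gamma> n \<in> Lp_fun p" ..
  show "limitin (Lp_topology p) (\<lambda>n. Lp_class p (dyadic_average \<gamma> n)) (Lp_class p \<gamma>) sequentially"
    by (rule limitin_Lp_topology[OF assms(2,3) in_Lp])
      (rule Lp_seminorm_dyadic_average_tendsto[OF assms(1,3,2)])
qed

end
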